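(* Let $\Omega$ be the random Fibonacci tiling space. Then the first Čech cohomology group $H^1(\Omega)$ (with integer coefficients) is not finitely generated.
   Context: Let $\mathcal{A}=\{a,b\}$. The random Fibonacci substitution $\zeta$ is $a\mapsto ba$ with probability $p$, $a\mapsto ab$ with probability $1-p$, and $b\mapsto a$, where $0<p<1$. It is applied locally: a realisation of $\zeta(w)$ for a word $w$ is any word obtained from $w$ by replacing each letter $b$ by $a$ and each letter $a$, independently for each occurrence, by either $ab$ or $ba$; realisations of $\zeta^k(b)$ are obtained by applying this step $k$ times starting with $b$. The symbolic random Fibonacci tiling space $\Sigma\subset\mathcal{A}^{\mathbb{Z}}$ is the set of all bi-infinite words $w$ such that every finite subword (block of consecutive letters) $u$ of $w$ is a subword of some realisation of $\zeta^k(b)$ for some $k\in\mathbb{N}$. It carries the subspace topology of the product topology on $\mathcal{A}^{\mathbb{Z}}$ and is invariant under the shift $S((w_i)_{i\in\mathbb{Z}})=(w_{i+1})_{i\in\mathbb{Z}}$. The random Fibonacci tiling space $\Omega$ is (up to homeomorphism) the suspension $\Omega=(\Sigma\times\mathbb{R})/\!\sim$, with the quotient topology, where $\sim$ is the equivalence relation generated by $(w,t)\sim(Sw,t-1)$ for all $w\in\Sigma$, $t\in\mathbb{R}$. *)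

theory Defs
  imports
    "HOL-Analysis.Analysis"
    "HOL-Algebra.Product_Groups"
    "HOL-Library.Sublist"
    "HOL-Probability.Probability_Mass_Function"
begin

section \<open>The random Fibonacci tiling space\<close>

datatype letter = La | Lb

definition random_fibonacci :: "real \<Rightarrow> letter \<Rightarrow> letter list pmf" where
  "random_fibonacci p x =
     (case x of
        La \<Rightarrow> map_pmf (\<lambda>heads. if heads then [Lb, La] else [La, Lb]) (bernoulli_pmf p)
      | Lb \<Rightarrow> return_pmf [La])"

definition realisation :: "real \<Rightarrow> letter list \<Rightarrow> letter list \<Rightarrow> bool" where
  "realisation p w v \<longleftrightarrow>
     (\<exists>us. list_all2 (\<lambda>x u. u \<in> set_pmf (random_fibonacci p x)) w us \<and> v = concat us)"

lemma set_random_fibonacci: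
  assumes "0 < p" "p < 1"
  shows "set_pmf (random_fibonacci p La) = {[La, Lb], [Lb, La]}"
    and "set_pmf (random_fibonacci p Lb) = {[La]}"
  using assms by (auto simp: random_fibonacci_def set_pmf_bernoulli)

definition fibonacci_words :: "real \<Rightarrow> (int \<Rightarrow> letter) set" where
  "fibonacci_words p =
     {w. \<forall>i j. \<exists>k v. (realisation p ^^ k) [Lb] v \<and> sublist (map w [i..j]) v}"

definition fibonacci_symbolic :: "real \<Rightarrow> (int \<Rightarrow> letter) topology" where
  "fibonacci_symbolic p =
     subtopology (product_topology (\<lambda>_. discrete_topology UNIV) UNIV) (fibonacci_words p)"

definition shift :: "(int \<Rightarrow> letter) \<Rightarrow> int \<Rightarrow> letter" where
  "shift w = (\<lambda>i. w (i + 1))"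

definition quotient_topology :: "'a topology \<Rightarrow> ('a \<Rightarrow> 'b) \<Rightarrow> 'b topology" where
  "quotient_topology X q =
     topology (\<lambda>V. V \<subseteq> q ` topspace X \<and> openin X {x \<in> topspace X. q x \<in> V})"

lemma openin_quotient_topology:
  "openin (quotient_topology X q) V \<longleftrightarrow>
     V \<subseteq> q ` topspace X \<and> openin X {x \<in> topspace X. q x \<in> V}"
proof -
  have int: "{x \<in> topspace X. q x \<in> S \<inter> T} =
      {x \<in> topspace X. q x \<in> S} \<inter> {x \<in> topspace X. q x \<in> T}" for S T
    by auto
  have un: "{x \<in> topspace X. q x \<in> \<Union>\<K>} = (\<Union>K\<in>\<K>. {x \<in> topspace X. q x \<in> K})" for \<K>
    by auto
  have "istopology (\<lambda>V. V \<subseteq> q ` topspace X \<and> openin X {x \<in> topspace X. q x \<in> V})"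
    unfolding istopology_def int un by blast
  then show ?thesis
    by (simp add: quotient_topology_def topology_inverse')
qed

lemma topspace_quotient_topology [simp]: "topspace (quotient_topology X q) = q ` topspace X"
proof
  show "topspace (quotient_topology X q) \<subseteq> q ` topspace X"
    unfolding topspace_def by (auto simp: openin_quotient_topology topspace_def)
  have "{x \<in> topspace X. q x \<in> q ` topspace X} = topspace X"
    by auto
  then show "q ` topspace X \<subseteq> topspace (quotient_topology X q)"
    by (intro openin_subset) (simp add: openin_quotient_topology)
qed

lemma quotient_map_quotient_topology: "quotient_map X (quotient_topology X q) q"
  by (auto simp: quotient_map_def openin_quotient_topology)

definition suspension_rel :: "'a set \<Rightarrow> ('a \<Rightarrow> 'a) \<Rightarrow> (('a \<times> real) \<times> ('a \<times> real)) set" where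
  "suspension_rel S T =
     (let r = {((x, t), (T x, t - 1)) | x t. x \<in> S}
      in Restr ((r \<union> r\<inverse>)\<^sup>*) (S \<times> UNIV))"

definition suspension :: "'a topology \<Rightarrow> ('a \<Rightarrow> 'a) \<Rightarrow> ('a \<times> real) set topology" where
  "suspension X T =
     quotient_topology (prod_topology X euclideanreal) (\<lambda>y. suspension_rel (topspace X) T `` {y})"

lemma equiv_suspension_rel: "equiv (S \<times> UNIV) (suspension_rel S T)"
proof -
  define r where "r = {((x, t), (T x, t - (1::real))) | x t. x \<in> S}"
  have "sym ((r \<union> r\<inverse>)\<^sup>*)"
    by (intro sym_rtrancl) (auto simp: sym_def)
  then have "equiv (S \<times> UNIV) (Restr ((r \<union> r\<inverse>)\<^sup>*) (S \<times> UNIV))"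
    by (intro equivI refl_onI symI transI) (auto dest: symD intro: rtrancl_trans)
  then show ?thesis
    by (simp only: suspension_rel_def Let_def r_def)
qed

definition random_fibonacci_space :: "real \<Rightarrow> ((int \<Rightarrow> letter) \<times> real) set topology" where
  "random_fibonacci_space p = suspension (fibonacci_symbolic p) shift"

section \<open>Cech cohomology with integer coefficients\<close>

text \<open>
  The direct limit, over all open covers, of the simplicial cohomology of the nerve. Simplices of
  the nerve are ordered and may repeat vertices, and cochains need not be alternating; this complex
  computes the same cohomology as the oriented one. A cochain on the \<open>n\<close>-simplices is represented
  by a function on all lists that vanishes outside \<open>nerve U n\<close>.
\<close>

definition open_cover :: "'a topology \<Rightarrow> 'a set set \<Rightarrow> bool" where
  "open_cover X U \<longleftrightarrow> (\<forall>u\<in>U. openin X u) \<and> \<Union>U = topspace X"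

definition nerve :: "'a set set \<Rightarrow> nat \<Rightarrow> 'a set list set" where
  "nerve U n = {s. length s = Suc n \<and> set s \<subseteq> U \<and> \<Inter>(set s) \<noteq> {}}"

type_synonym 'a cochain = "'a set list \<Rightarrow> int"

definition cochain_group :: "'a set set \<Rightarrow> nat \<Rightarrow> 'a cochain monoid" where
  "cochain_group U n =
     \<lparr>carrier = {c. \<forall>s. s \<notin> nerve U n \<longrightarrow> c s = 0},
      monoid.mult = (\<lambda>c d s. c s + d s), one = (\<lambda>_. 0)\<rparr>"

definition face :: "nat \<Rightarrow> 'b list \<Rightarrow> 'b list" where
  "face i s = take i s @ drop (Suc i) s"

definition coboundary :: "'a set set \<Rightarrow> nat \<Rightarrow> 'a cochain \<Rightarrow> 'a cochain" where
  "coboundary U n c =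
     (\<lambda>s. if s \<in> nerve U (Suc n) then \<Sum>i\<le>Suc n. (- 1) ^ i * c (face i s) else 0)"

definition cocycle_group :: "'a set set \<Rightarrow> nat \<Rightarrow> 'a cochain monoid" where
  "cocycle_group U n =
     cochain_group U n \<lparr>carrier := {c \<in> carrier (cochain_group U n). coboundary U n c = (\<lambda>_. 0)}\<rparr>"

definition coboundaries :: "'a set set \<Rightarrow> nat \<Rightarrow> 'a cochain set" where
  "coboundaries U n =
     (case n of 0 \<Rightarrow> {\<lambda>_. 0} | Suc m \<Rightarrow> coboundary U m ` carrier (cochain_group U m))"

definition nerve_cohomology :: "'a set set \<Rightarrow> nat \<Rightarrow> 'a cochain set monoid" where
  "nerve_cohomology U n = cocycle_group U n Mod coboundaries U n"

definition refinement :: "'a set set \<Rightarrow> 'a set set \<Rightarrow> ('a set \<Rightarrow> 'a set) \<Rightarrow> bool" where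
  "refinement U V r \<longleftrightarrow> (\<forall>v\<in>V. r v \<in> U \<and> v \<subseteq> r v)"

definition cochain_pullback ::
    "'a set set \<Rightarrow> nat \<Rightarrow> ('a set \<Rightarrow> 'a set) \<Rightarrow> 'a cochain \<Rightarrow> 'a cochain" where
  "cochain_pullback V n r c = (\<lambda>s. if s \<in> nerve V n then c (map r s) else 0)"

text \<open>A cohomology class \<open>h\<close> is a coset of cocycles; all of them contribute the same coset to the union.\<close>

definition refinement_map ::
    "'a set set \<Rightarrow> nat \<Rightarrow> ('a set \<Rightarrow> 'a set) \<Rightarrow> 'a cochain set \<Rightarrow> 'a cochain set" where
  "refinement_map V n r h =
     (\<Union>c\<in>h. coboundaries V n #>\<^bsub>cocycle_group V n\<^esub> cochain_pullback V n r c)"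

text \<open>
  The direct limit of the abelian groups \<open>G i\<close>, \<open>i \<in> I\<close>, along the homomorphisms \<open>f : G i \<rightarrow> G j\<close>
  with \<open>(i, j, f) \<in> F\<close>: the direct sum of the \<open>G i\<close> modulo the subgroup generated by the elements
  \<open>\<iota> i x - \<iota> j (f x)\<close>.
\<close>

definition sum_inclusion :: "'i set \<Rightarrow> ('i \<Rightarrow> 'g monoid) \<Rightarrow> 'i \<Rightarrow> 'g \<Rightarrow> 'i \<Rightarrow> 'g" where
  "sum_inclusion I G i x = (\<lambda>j\<in>I. if j = i then x else \<one>\<^bsub>G j\<^esub>)"

definition limit_relators ::
    "'i set \<Rightarrow> ('i \<Rightarrow> 'g monoid) \<Rightarrow> ('i \<times> 'i \<times> ('g \<Rightarrow> 'g)) set \<Rightarrow> ('i \<Rightarrow> 'g) set" where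
  "limit_relators I G F =
     {sum_inclusion I G i x \<otimes>\<^bsub>sum_group I G\<^esub> inv\<^bsub>sum_group I G\<^esub> sum_inclusion I G j (f x)
      | i j f x. (i, j, f) \<in> F \<and> x \<in> carrier (G i)}"

definition direct_limit ::
    "'i set \<Rightarrow> ('i \<Rightarrow> 'g monoid) \<Rightarrow> ('i \<times> 'i \<times> ('g \<Rightarrow> 'g)) set \<Rightarrow> ('i \<Rightarrow> 'g) set monoid" where
  "direct_limit I G F = sum_group I G Mod generate (sum_group I G) (limit_relators I G F)"

text \<open>
  All refinement functions between two covers are admitted as connecting maps. They induce one and
  the same homomorphism in cohomology, so this is the direct limit over the directed set of open
  covers.
\<close>

definition cech_cohomology ::
    "'a topology \<Rightarrow> nat \<Rightarrow> ('a set set \<Rightarrow> 'a cochain set) set monoid" where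
  "cech_cohomology X n =
     direct_limit {U. open_cover X U} (\<lambda>U. nerve_cohomology U n)
       {(U, V, refinement_map V n r) | U V r. open_cover X U \<and> open_cover X V \<and> refinement U V r}"

definition finitely_generated :: "('a, 'b) monoid_scheme \<Rightarrow> bool" where
  "finitely_generated G \<longleftrightarrow> (\<exists>S. finite S \<and> S \<subseteq> carrier G \<and> generate G S = carrier G)"

subsection \<open>The constructions above yield abelian groups\<close>

lemma comm_group_cochain_group: "comm_group (cochain_group U n)"
proof (rule comm_groupI)
  fix c assume "c \<in> carrier (cochain_group U n)"
  then show "\<exists>d\<in>carrier (cochain_group U n). d \<otimes>\<^bsub>cochain_group U n\<^esub> c = \<one>\<^bsub>cochain_group U n\<^esub>"
    by (intro bexI[of _ "\<lambda>s. - c s"]) (auto simp: cochain_group_def)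
qed (auto simp: cochain_group_def fun_eq_iff)

lemma coboundary_add:
  "coboundary U n (\<lambda>s. c s + d s) = (\<lambda>s. coboundary U n c s + coboundary U n d s)"
  by (auto simp: coboundary_def fun_eq_iff sum.distrib algebra_simps)

lemma coboundary_closed: "coboundary U n c \<in> carrier (cochain_group U (Suc n))"
  by (simp add: coboundary_def cochain_group_def)

lemma coboundary_hom: "coboundary U n \<in> hom (cochain_group U n) (cochain_group U (Suc n))"
proof (rule homI)
  show "coboundary U n (c \<otimes>\<^bsub>cochain_group U n\<^esub> d) =
      coboundary U n c \<otimes>\<^bsub>cochain_group U (Suc n)\<^esub> coboundary U n d" for c d
    using coboundary_add[of U n c d] by (simp add: cochain_group_def)
qed (rule coboundary_closed)

lemma face_face:
  assumes "i \<le> j"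
  shows "face i (face (Suc j) s) = face j (face i s)"
proof (cases "i < length s")
  case True
  with assms show ?thesis
    by (simp add: face_def take_drop min_def add.commute)
next
  case False
  with assms show ?thesis
    by (simp add: face_def)
qed

lemma face_nerve:
  assumes "s \<in> nerve U (Suc n)" "i \<le> Suc n"
  shows "face i s \<in> nerve U n"
proof -
  have "set (face i s) \<subseteq> set s"
    unfolding face_def by (auto dest: in_set_takeD in_set_dropD)
  moreover from this have "\<Inter>(set s) \<subseteq> \<Inter>(set (face i s))"
    by (rule Inter_anti_mono)
  moreover have "length (face i s) = Suc n"
    using assms by (simp add: nerve_def face_def)
  ultimately show ?thesis
    using assms by (auto simp: nerve_def)
qed

lemma coboundary_coboundary: "coboundary U (Suc n) (coboundary U n c) = (\<lambda>_. 0)"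
proof
  fix s
  show "coboundary U (Suc n) (coboundary U n c) s = 0"
  proof (cases "s \<in> nerve U (Suc (Suc n))")
    case True
    define g where "g = (\<lambda>(j, i). (- 1) ^ (i + j) * c (face i (face j s)))"
    let ?P = "{..Suc (Suc n)} \<times> {..Suc n}"
    let ?L = "{(j, i). i \<le> n + 1 \<and> j \<le> i}" and ?H = "{(j, i). j \<le> n + 2 \<and> i < j}"
    have "coboundary U (Suc n) (coboundary U n c) s =
        (\<Sum>j\<le>Suc (Suc n). \<Sum>i\<le>Suc n. g (j, i))"
      using True face_nerve[OF True]
      by (simp add: coboundary_def g_def sum_distrib_left power_add mult.assoc mult.left_commute
          del: sum.atMost_Suc)
    also have "\<dots> = sum g ?P"
      by (simp add: sum.cartesian_product del: sum.atMost_Suc)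
    also have "?P = ?L \<union> ?H"
      by auto
    also have "sum g (?L \<union> ?H) = sum g ?L + sum g ?H"
    proof (rule sum.union_disjoint)
      have "?L \<subseteq> {..n + 1} \<times> {..n + 1}" "?H \<subseteq> {..n + 2} \<times> {..n + 2}"
        by auto
      then show "finite ?L" "finite ?H"
        by (meson finite_SigmaI finite_atMost finite_subset)+
    qed auto
    also have "sum g ?H = (\<Sum>x\<in>?L. - g x)"
    proof (rule sum.reindex_bij_witness[where i = "\<lambda>(j, i). (Suc i, j)" and j = "\<lambda>(j, i). (i, j - 1)"])
      fix x assume "x \<in> ?H"
      then obtain j i where x: "x = (Suc j, i)" "i \<le> j"
        by (cases x, cases "fst x") auto
      show "- g (case x of (j, i) \<Rightarrow> (i, j - 1)) = g x"
        using face_face[OF x(2), of s] by (simp add: x g_def add.commute)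
    qed auto
    finally show ?thesis
      by (simp add: sum_negf)
  qed (simp add: coboundary_def)
qed

lemma subgroup_cocycles:
  "subgroup {c \<in> carrier (cochain_group U n). coboundary U n c = (\<lambda>_. 0)} (cochain_group U n)"
proof -
  interpret group_hom "cochain_group U n" "cochain_group U (Suc n)" "coboundary U n"
    by (intro group_hom.intro group_hom_axioms.intro coboundary_hom comm_group.axioms(2)
        comm_group_cochain_group)
  show ?thesis
    using subgroup_kernel by (simp add: kernel_def cochain_group_def)
qed

lemma comm_group_cocycle_group: "comm_group (cocycle_group U n)"
proof (rule group.group_comm_groupI)
  show "group (cocycle_group U n)"
    unfolding cocycle_group_def
    by (intro subgroup.subgroup_is_group subgroup_cocycles comm_group.axioms(2) comm_group_cochain_group)
qed (simp add: cocycle_group_def cochain_group_def add.commute)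

lemma subgroup_coboundaries: "subgroup (coboundaries U n) (cocycle_group U n)"
proof -
  interpret Z: comm_group "cocycle_group U n"
    by (rule comm_group_cocycle_group)
  have "subgroup (coboundaries U n) (cochain_group U n)"
  proof (cases n)
    case 0
    interpret comm_group "cochain_group U 0"
      by (rule comm_group_cochain_group)
    show ?thesis
      using triv_subgroup 0 by (simp add: coboundaries_def cochain_group_def)
  next
    case (Suc m)
    interpret group_hom "cochain_group U m" "cochain_group U (Suc m)" "coboundary U m"
      by (intro group_hom.intro group_hom_axioms.intro coboundary_hom comm_group.axioms(2)
        comm_group_cochain_group)
    show ?thesis
      using img_is_subgroup Suc by (simp add: coboundaries_def)
  qed
  moreover have "coboundaries U n \<subseteq> carrier (cocycle_group U n)"
  proof (cases n)
    case 0
    then show ?thesis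
      by (auto simp: coboundaries_def cocycle_group_def cochain_group_def coboundary_def fun_eq_iff)
  next
    case (Suc m)
    then show ?thesis
      by (auto simp: coboundaries_def cocycle_group_def coboundary_coboundary coboundary_closed)
  qed
  ultimately show ?thesis
    using group.subgroup_incl[OF comm_group.axioms(2)[OF comm_group_cochain_group] _ subgroup_cocycles]
    by (simp add: cocycle_group_def)
qed

lemma comm_group_nerve_cohomology: "comm_group (nerve_cohomology U n)"
  unfolding nerve_cohomology_def
  by (intro comm_group.abelian_FactGroup comm_group_cocycle_group subgroup_coboundaries)

lemma map_nerve:
  assumes "refinement U V r" "s \<in> nerve V n"
  shows "map r s \<in> nerve U n"
proof -
  have "\<Inter>(set s) \<subseteq> \<Inter>(set (map r s))" "set (map r s) \<subseteq> U"
    using assms by (fastforce simp: nerve_def refinement_def)+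
  with assms(2) show ?thesis
    by (auto simp: nerve_def)
qed

lemma map_face: "map r (face i s) = face i (map r s)"
  by (simp add: face_def take_map drop_map)

lemma coboundary_pullback:
  assumes "refinement U V r"
  shows "coboundary V n (cochain_pullback V n r c) = cochain_pullback V (Suc n) r (coboundary U n c)"
  using assms
  by (auto simp: fun_eq_iff coboundary_def cochain_pullback_def map_nerve face_nerve map_face
      simp del: sum.atMost_Suc)

lemma cochain_pullback_hom:
  "cochain_pullback V n r \<in> hom (cochain_group U n) (cochain_group V n)"
  by (rule homI) (auto simp: cochain_pullback_def cochain_group_def fun_eq_iff)

lemma cocycle_pullback_hom:
  assumes "refinement U V r"
  shows "cochain_pullback V n r \<in> hom (cocycle_group U n) (cocycle_group V n)"
  using cochain_pullback_hom[of V n r U] coboundary_pullback[OF assms, of n]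
  by (auto simp: hom_def cocycle_group_def Pi_iff cochain_pullback_def fun_eq_iff)

lemma coboundaries_pullback:
  assumes "refinement U V r" "c \<in> coboundaries U n"
  shows "cochain_pullback V n r c \<in> coboundaries V n"
proof (cases n)
  case 0
  with assms show ?thesis
    by (simp add: coboundaries_def cochain_pullback_def)
next
  case (Suc m)
  with assms obtain d where d: "d \<in> carrier (cochain_group U m)" "c = coboundary U m d"
    by (auto simp: coboundaries_def)
  have "cochain_pullback V m r d \<in> carrier (cochain_group V m)"
    using cochain_pullback_hom d(1) by (rule hom_in_carrier)
  then have "coboundary V m (cochain_pullback V m r d) \<in> coboundaries V n"
    using Suc by (simp add: coboundaries_def)
  then show ?thesis
    using d(2) Suc by (simp add: coboundary_pullback[OF assms(1)])
qed

lemma refinement_map_coset: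
  assumes r: "refinement U V r" and c: "c \<in> carrier (cocycle_group U n)"
  shows "refinement_map V n r (coboundaries U n #>\<^bsub>cocycle_group U n\<^esub> c) =
         coboundaries V n #>\<^bsub>cocycle_group V n\<^esub> cochain_pullback V n r c"
proof -
  interpret Z: comm_group "cocycle_group U n"
    by (rule comm_group_cocycle_group)
  interpret W: comm_group "cocycle_group V n"
    by (rule comm_group_cocycle_group)
  note BU = subgroup_coboundaries[of U n] and BV = subgroup_coboundaries[of V n]
  have "coboundaries V n #>\<^bsub>cocycle_group V n\<^esub> cochain_pullback V n r d =
        coboundaries V n #>\<^bsub>cocycle_group V n\<^esub> cochain_pullback V n r c"
    if d: "d \<in> coboundaries U n #>\<^bsub>cocycle_group U n\<^esub> c" for d
  proof -
    obtain b where b: "b \<in> coboundaries U n" "d = b \<otimes>\<^bsub>cocycle_group U n\<^esub> c"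
      using d by (auto simp: r_coset_def)
    have "cochain_pullback V n r d =
        cochain_pullback V n r b \<otimes>\<^bsub>cocycle_group V n\<^esub> cochain_pullback V n r c"
      using hom_mult[OF cocycle_pullback_hom[OF r]] b c subgroup.subset[OF BU] by blast
    then have "cochain_pullback V n r d \<in>
        coboundaries V n #>\<^bsub>cocycle_group V n\<^esub> cochain_pullback V n r c"
      using coboundaries_pullback[OF r b(1)] by (auto simp: r_coset_def)
    then show ?thesis
      using W.repr_independence[OF _ _ BV] hom_in_carrier[OF cocycle_pullback_hom[OF r] c] by metis
  qed
  moreover have "c \<in> coboundaries U n #>\<^bsub>cocycle_group U n\<^esub> c"
    by (rule Z.rcos_self[OF c BU])
  ultimately show ?thesis
    unfolding refinement_map_def by (metis (no_types, lifting) SUP_eq_const empty_iff)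
qed

lemma refinement_map_hom:
  assumes r: "refinement U V r"
  shows "refinement_map V n r \<in> hom (nerve_cohomology U n) (nerve_cohomology V n)"
proof (rule homI)
  interpret Z: comm_group "cocycle_group U n"
    by (rule comm_group_cocycle_group)
  interpret W: comm_group "cocycle_group V n"
    by (rule comm_group_cocycle_group)
  interpret BU: normal "coboundaries U n" "cocycle_group U n"
    by (rule Z.subgroup_imp_normal[OF subgroup_coboundaries])
  interpret BV: normal "coboundaries V n" "cocycle_group V n"
    by (rule W.subgroup_imp_normal[OF subgroup_coboundaries])
  note hom = cocycle_pullback_hom[OF r, of n]
  fix h assume "h \<in> carrier (nerve_cohomology U n)"
  then obtain c where c: "c \<in> carrier (cocycle_group U n)"
      "h = coboundaries U n #>\<^bsub>cocycle_group U n\<^esub> c"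
    by (auto simp: nerve_cohomology_def FactGroup_def RCOSETS_def)
  have pc: "cochain_pullback V n r c \<in> carrier (cocycle_group V n)"
    using hom c(1) by (rule hom_in_carrier)
  then show "refinement_map V n r h \<in> carrier (nerve_cohomology V n)"
    using refinement_map_coset[OF r c(1)] c(2)
    by (auto simp: nerve_cohomology_def FactGroup_def RCOSETS_def)
  fix k assume "k \<in> carrier (nerve_cohomology U n)"
  then obtain d where d: "d \<in> carrier (cocycle_group U n)"
      "k = coboundaries U n #>\<^bsub>cocycle_group U n\<^esub> d"
    by (auto simp: nerve_cohomology_def FactGroup_def RCOSETS_def)
  have pd: "cochain_pullback V n r d \<in> carrier (cocycle_group V n)"
    using hom d(1) by (rule hom_in_carrier)
  show "refinement_map V n r (h \<otimes>\<^bsub>nerve_cohomology U n\<^esub> k) =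
      refinement_map V n r h \<otimes>\<^bsub>nerve_cohomology V n\<^esub> refinement_map V n r k"
    using c d pc pd
    by (simp add: nerve_cohomology_def FactGroup_def BU.rcos_sum BV.rcos_sum
        refinement_map_coset[OF r] hom_mult[OF hom])
qed

lemma sum_inclusion_closed:
  assumes "\<And>i. i \<in> I \<Longrightarrow> group (G i)" "i \<in> I" "x \<in> carrier (G i)"
  shows "sum_inclusion I G i x \<in> carrier (sum_group I G)"
proof -
  have "finite {j \<in> I. sum_inclusion I G i x j \<noteq> \<one>\<^bsub>G j\<^esub>}"
    by (rule finite_subset[of _ "{i}"]) (auto simp: sum_inclusion_def)
  with assms show ?thesis
    by (auto simp: carrier_sum_group sum_inclusion_def group.is_monoid)
qed

lemma comm_group_direct_limit:
  assumes G: "\<And>i. i \<in> I \<Longrightarrow> comm_group (G i)"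
    and F: "\<And>i j f. (i, j, f) \<in> F \<Longrightarrow> i \<in> I \<and> j \<in> I \<and> f \<in> hom (G i) (G j)"
  shows "comm_group (direct_limit I G F)"
proof -
  have gr: "group (G i)" if "i \<in> I" for i
    using G[OF that] by (rule comm_group.axioms(2))
  interpret S: group "sum_group I G"
    by (rule sum_group[OF gr])
  have "comm_group (sum_group I G)"
  proof (rule S.group_comm_groupI)
    fix x y assume "x \<in> carrier (sum_group I G)" "y \<in> carrier (sum_group I G)"
    then have "x i \<otimes>\<^bsub>G i\<^esub> y i = y i \<otimes>\<^bsub>G i\<^esub> x i" if "i \<in> I" for i
      using that gr comm_groupE(4)[OF G[OF that]] by (auto simp: carrier_sum_group PiE_iff)
    then show "x \<otimes>\<^bsub>sum_group I G\<^esub> y = y \<otimes>\<^bsub>sum_group I G\<^esub> x"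
      by (auto simp: fun_eq_iff restrict_def)
  qed
  moreover have "limit_relators I G F \<subseteq> carrier (sum_group I G)"
    using F gr
    by (auto simp del: mult_sum_group simp: limit_relators_def intro!: S.m_closed S.inv_closed sum_inclusion_closed
        dest: hom_in_carrier)
  ultimately show ?thesis
    unfolding direct_limit_def
    by (intro comm_group.abelian_FactGroup S.generate_is_subgroup)
qed

theorem comm_group_cech_cohomology: "comm_group (cech_cohomology X n)"
  unfolding cech_cohomology_def
  by (rule comm_group_direct_limit) (auto intro: comm_group_nerve_cohomology refinement_map_hom)

end

theory Submission
  imports Defs
begin

text \<open>
  The cohomology group is detected by homomorphisms to the integers that come from pairs of points
  of the subshift which differ in finitely many letters only.

  Along the flow line \<open>t \<mapsto> [(x, t)]\<close> of a point \<open>x\<close>, every Cech 1-cocycle \<open>c\<close> becomes a coboundary,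
  because a line carries no cohomology: \<open>c\<close> has a primitive, unique up to an additive constant. Let
  \<open>x\<close> and \<open>y\<close> differ in finitely many letters. By compactness, for any given open cover the points
  \<open>[(x, t)]\<close> and \<open>[(y, t)]\<close> lie in a common member as soon as \<open>\<bar>t\<bar>\<close> is large
  (\<open>asymptotic_in_flow\<close>). Hence the difference of the primitives along the two lines is constant near
  each of the two ends. The jump between the two constants, the holonomy of \<open>c\<close>, vanishes on
  coboundaries and is compatible with refinement, so it defines a homomorphism \<open>\<Phi>\<close> on the first
  cohomology (\<open>homoclinic_functional\<close>).

  A clopen set \<open>C\<close> of the subshift defines a cohomology class that counts the crossings of a flow line
  with the section \<open>C \<times> {1/2}\<close>. If every orbit under consideration meets \<open>C\<close> at most at time \<open>0\<close>, then
  \<open>\<Phi>\<close> takes the value \<open>[x \<in> C] - [y \<in> C]\<close> on that class (\<open>holonomy_crossing_cocycle\<close>).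

  It remains to find points and sets for which these values form an identity matrix. Take the
  right-infinite word \<open>r = baababaa...\<close> that is the limit of \<open>f (n + 2) = f (n + 1) f n\<close>,
  \<open>f 0 = ba\<close>, \<open>f 1 = baa\<close>, and join it to its mirror image: the resulting palindrome \<open>x\<close> contains the
  word \<open>bb\<close> only at its centre. The block \<open>ba\<close> in \<open>r\<close> at position \<open>q i = \<bar>f (i + 2)\<bar>\<close> is a realisation
  of the image of a letter \<open>a\<close>, and the other realisation \<open>ab\<close> is just as good; replacing the one by the
  other creates no further \<open>bb\<close> and gives a point \<open>y i\<close>. Let \<open>C j\<close> be the set of points with \<open>bb\<close> at the
  centre and \<open>b\<close> at position \<open>q j\<close>. Then \<open>x \<in> C j\<close> for all \<open>j\<close>, whereas \<open>y i \<in> C j\<close> if and only if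
  \<open>i \<noteq> j\<close>. So the functionals of the pairs \<open>(x, y i)\<close> and the classes of the \<open>C j\<close> are dual to each other,
  and a group with an infinite dual family is not finitely generated: modulo \<open>2\<close>, the functionals
  take finitely many values on a group with finitely many generators.
\<close>

section \<open>Integer functionals on a direct limit of abelian groups\<close>

text \<open>
  Send \<open>g\<close> to the set of all \<open>i\<close> for which \<open>\<phi> i g\<close> is odd. Products become symmetric differences,
  so finitely many generators produce finitely many such sets, but \<open>h j\<close> is sent to \<open>{j}\<close>.
\<close>
lemma not_finitely_generated_if_dual_family:
  fixes \<phi> :: "nat \<Rightarrow> 'a \<Rightarrow> int"
  assumes G: "group G"
    and \<phi>: "\<And>i. \<phi> i \<in> hom G integer_group"
    and h: "\<And>j. h j \<in> carrier G"
    and dual: "\<And>i j. \<phi> i (h j) = (if i = j then 1 else 0)"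
  shows "\<not> finitely_generated G"
proof
  assume "finitely_generated G"
  then obtain S where S: "finite S" "S \<subseteq> carrier G" "generate G S = carrier G"
    by (auto simp: finitely_generated_def)
  define parity where "parity g = {i. odd (\<phi> i g)}" for g
  \<comment> \<open>the value forced by the parities on a product of the elements of \<open>T\<close>\<close>
  define combine where "combine T = {i. odd (card {s \<in> T. i \<in> parity s})}" for T
  have combine_sym_diff: "\<exists>T\<subseteq>S. combine T = sym_diff (combine T1) (combine T2)"
    if "T1 \<subseteq> S" "T2 \<subseteq> S" for T1 T2
  proof (intro exI conjI)
    have fin: "finite T1" "finite T2"
      using that S(1) by (auto intro: finite_subset)
    have "odd (card {s \<in> sym_diff T1 T2. i \<in> parity s}) \<longleftrightarrow>
        odd (card {s \<in> T1. i \<in> parity s}) \<noteq> odd (card {s \<in> T2. i \<in> parity s})" for i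
    proof -
      let ?A = "{s \<in> T1. i \<in> parity s}" and ?B = "{s \<in> T2. i \<in> parity s}"
      have "card ?A = card (?A \<inter> ?B) + card (?A - ?B)"
        using fin by (intro card_Int_Diff) simp
      moreover have "card ?B = card (?A \<inter> ?B) + card (?B - ?A)"
        using fin card_Int_Diff[of ?B ?A] by (simp add: Int_commute)
      moreover have "card {s \<in> sym_diff T1 T2. i \<in> parity s} = card (?A - ?B) + card (?B - ?A)"
      proof -
        have "{s \<in> sym_diff T1 T2. i \<in> parity s} = (?A - ?B) \<union> (?B - ?A)"
          by auto
        then show ?thesis
          using fin by (simp only:) (rule card_Un_disjoint; auto)
      qed
      ultimately show ?thesis
        by auto
    qed
    then show "combine (sym_diff T1 T2) = sym_diff (combine T1) (combine T2)"
      by (auto simp: combine_def)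
  qed (use that in auto)
  have "\<exists>T\<subseteq>S. parity g = combine T" if "g \<in> generate G S" for g
    using that
  proof (induction rule: generate.induct)
    case one
    have "\<phi> i \<one>\<^bsub>G\<^esub> = 0" for i
      using hom_one[OF \<phi> G group_integer_group] by simp
    then show ?case
      by (intro exI[of _ "{}"]) (simp add: parity_def combine_def)
  next
    case (incl s)
    have "{t \<in> {s}. i \<in> parity t} = (if i \<in> parity s then {s} else {})" for i
      by auto
    then have "combine {s} = parity s"
      by (auto simp: combine_def)
    with incl show ?case by blast
  next
    case (inv s)
    have "\<phi> i (inv\<^bsub>G\<^esub> s) = - \<phi> i s" for i
      using group_hom.hom_inv[of G integer_group "\<phi> i" s] inv S(2) G \<phi>
      by (auto simp: group_hom_def group_hom_axioms_def)
    then have "parity (inv\<^bsub>G\<^esub> s) = parity s"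
      by (simp add: parity_def)
    moreover have "{t \<in> {s}. i \<in> parity t} = (if i \<in> parity s then {s} else {})" for i
      by auto
    then have "combine {s} = parity s"
      by (auto simp: combine_def)
    ultimately show ?case using inv by blast
  next
    case (eng g1 g2)
    then have "g1 \<in> carrier G" "g2 \<in> carrier G"
      using S(3) by auto
    then have "\<phi> i (g1 \<otimes>\<^bsub>G\<^esub> g2) = \<phi> i g1 + \<phi> i g2" for i
      using hom_mult[OF \<phi>] by simp
    then have "parity (g1 \<otimes>\<^bsub>G\<^esub> g2) = sym_diff (parity g1) (parity g2)"
      by (auto simp: parity_def)
    with eng.IH combine_sym_diff show ?case by metis
  qed
  then have "parity ` carrier G \<subseteq> combine ` Pow S"
    using S(3) by blast
  moreover have "finite (combine ` Pow S)"
    using S(1) by simp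
  ultimately have "finite (parity ` carrier G)"
    by (rule finite_subset)
  moreover have "parity (h j) = {j}" for j
    using dual by (auto simp: parity_def)
  then have "range (\<lambda>j. {j}) \<subseteq> parity ` carrier G"
    using h by (metis image_eqI image_subsetI)
  ultimately have "finite (range (\<lambda>j::nat. {j}))"
    by (rule finite_subset[rotated])
  then show False
    using finite_imageD[of "\<lambda>j::nat. {j}" UNIV] by (simp add: inj_on_def)
qed

lemma comm_group_sum_group:
  assumes "\<And>i. i \<in> I \<Longrightarrow> comm_group (G i)"
  shows "comm_group (sum_group I G)"
proof (rule group.group_comm_groupI)
  have gr: "group (G i)" if "i \<in> I" for i
    using assms[OF that] by (rule comm_group.axioms(2))
  then show "group (sum_group I G)"
    by simp
  fix x y assume "x \<in> carrier (sum_group I G)" "y \<in> carrier (sum_group I G)"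
  then have "x i \<otimes>\<^bsub>G i\<^esub> y i = y i \<otimes>\<^bsub>G i\<^esub> x i" if "i \<in> I" for i
    using that gr comm_groupE(4)[OF assms[OF that]] by (auto simp: carrier_sum_group PiE_iff)
  then show "x \<otimes>\<^bsub>sum_group I G\<^esub> y = y \<otimes>\<^bsub>sum_group I G\<^esub> x"
    by (auto simp: fun_eq_iff restrict_def)
qed

definition limit_class ::
    "'i set \<Rightarrow> ('i \<Rightarrow> 'g monoid) \<Rightarrow> ('i \<times> 'i \<times> ('g \<Rightarrow> 'g)) set \<Rightarrow> 'i \<Rightarrow> 'g \<Rightarrow> ('i \<Rightarrow> 'g) set" where
  "limit_class I G F i x =
     generate (sum_group I G) (limit_relators I G F) #>\<^bsub>sum_group I G\<^esub> sum_inclusion I G i x"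

lemma limit_class_closed:
  assumes "\<And>i. i \<in> I \<Longrightarrow> comm_group (G i)" "i \<in> I" "x \<in> carrier (G i)"
  shows "limit_class I G F i x \<in> carrier (direct_limit I G F)"
  using assms sum_inclusion_closed[of I G i x]
  by (auto simp: direct_limit_def FactGroup_def RCOSETS_def limit_class_def comm_group.axioms(2))

text \<open>
  The universal property of the direct limit, for maps into the integers: a compatible family adds up
  to a homomorphism on the direct sum, and compatibility says that it kills the relators.
\<close>
lemma direct_limit_functional:
  fixes \<phi> :: "'i \<Rightarrow> 'g \<Rightarrow> int"
  assumes G: "\<And>i. i \<in> I \<Longrightarrow> comm_group (G i)"
    and F: "\<And>i j f. (i, j, f) \<in> F \<Longrightarrow> i \<in> I \<and> j \<in> I \<and> f \<in> hom (G i) (G j)"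
    and \<phi>: "\<And>i. i \<in> I \<Longrightarrow> \<phi> i \<in> hom (G i) integer_group"
    and compatible: "\<And>i j f x. (i, j, f) \<in> F \<Longrightarrow> x \<in> carrier (G i) \<Longrightarrow> \<phi> j (f x) = \<phi> i x"
  obtains \<Phi> where "\<Phi> \<in> hom (direct_limit I G F) integer_group"
    and "\<And>i x. i \<in> I \<Longrightarrow> x \<in> carrier (G i) \<Longrightarrow> \<Phi> (limit_class I G F i x) = \<phi> i x"
proof -
  let ?S = "sum_group I G" and ?R = "limit_relators I G F"
  \<comment> \<open>the sum is finite for elements of the direct sum, which have finite support\<close>
  define \<sigma> where "\<sigma> x = (\<Sum>i | i \<in> I \<and> x i \<noteq> \<one>\<^bsub>G i\<^esub>. \<phi> i (x i))" for x
  have gr: "group (G i)" if "i \<in> I" for i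
    using G[OF that] by (rule comm_group.axioms(2))
  interpret S: comm_group ?S
    by (rule comm_group_sum_group[OF G])
  have \<phi>_one: "\<phi> i \<one>\<^bsub>G i\<^esub> = 0" if "i \<in> I" for i
    using hom_one[OF \<phi>[OF that] gr[OF that] group_integer_group] by simp
  have \<sigma>_eq: "\<sigma> x = (\<Sum>i\<in>J. \<phi> i (x i))"
    if "finite J" "J \<subseteq> I" "{i. i \<in> I \<and> x i \<noteq> \<one>\<^bsub>G i\<^esub>} \<subseteq> J" for x J
    unfolding \<sigma>_def by (rule sum.mono_neutral_left) (use that \<phi>_one in auto)
  have "\<sigma> \<in> hom ?S integer_group"
  proof (rule homI)
    fix x y assume "x \<in> carrier ?S" "y \<in> carrier ?S"
    then have fin: "finite {i \<in> I. x i \<noteq> \<one>\<^bsub>G i\<^esub>}" "finite {i \<in> I. y i \<noteq> \<one>\<^bsub>G i\<^esub>}"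
      and mem: "\<And>i. i \<in> I \<Longrightarrow> x i \<in> carrier (G i)" "\<And>i. i \<in> I \<Longrightarrow> y i \<in> carrier (G i)"
      by (auto simp: carrier_sum_group gr PiE_iff)
    let ?J = "{i \<in> I. x i \<noteq> \<one>\<^bsub>G i\<^esub>} \<union> {i \<in> I. y i \<noteq> \<one>\<^bsub>G i\<^esub>}"
    have "\<sigma> (x \<otimes>\<^bsub>?S\<^esub> y) = (\<Sum>i\<in>?J. \<phi> i (x i \<otimes>\<^bsub>G i\<^esub> y i))"
      using fin gr by (subst \<sigma>_eq[where J = ?J]) (auto simp: group.is_monoid intro!: sum.cong)
    also have "\<dots> = (\<Sum>i\<in>?J. \<phi> i (x i) + \<phi> i (y i))"
      using mem hom_mult[OF \<phi>] by (intro sum.cong) auto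
    also have "\<dots> = \<sigma> x + \<sigma> y"
      using fin by (subst (1 2) \<sigma>_eq[where J = ?J]) (auto simp: sum.distrib)
    finally show "\<sigma> (x \<otimes>\<^bsub>?S\<^esub> y) = \<sigma> x \<otimes>\<^bsub>integer_group\<^esub> \<sigma> y"
      by simp
  qed simp
  then interpret \<sigma>: group_hom ?S integer_group \<sigma>
    by (simp add: group_hom_def group_hom_axioms_def gr)
  have \<sigma>_incl: "\<sigma> (sum_inclusion I G i x) = \<phi> i x" if "i \<in> I" for i x
    using that by (subst \<sigma>_eq[where J = "{i}"]) (auto simp: sum_inclusion_def)
  have "?R \<subseteq> kernel ?S integer_group \<sigma>"
  proof
    fix z assume "z \<in> ?R"
    then obtain i j f x where z: "(i, j, f) \<in> F" "x \<in> carrier (G i)"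
      "z = sum_inclusion I G i x \<otimes>\<^bsub>?S\<^esub> inv\<^bsub>?S\<^esub> sum_inclusion I G j (f x)"
      by (auto simp: limit_relators_def)
    have ij: "i \<in> I" "j \<in> I" "f x \<in> carrier (G j)"
      using F[OF z(1)] z(2) by (auto dest: hom_in_carrier)
    have cl: "sum_inclusion I G i x \<in> carrier ?S" "sum_inclusion I G j (f x) \<in> carrier ?S"
      using gr ij z(2) by (auto intro: sum_inclusion_closed)
    have "\<sigma> z = \<phi> i x - \<phi> j (f x)"
      using cl ij by (simp add: z(3) \<sigma>_incl del: mult_sum_group inv_sum_group)
    then show "z \<in> kernel ?S integer_group \<sigma>"
      using cl compatible[OF z(1,2)] by (simp add: z(3) kernel_def del: mult_sum_group inv_sum_group)
  qed
  then have "generate ?S ?R \<subseteq> kernel ?S integer_group \<sigma>" "?R \<subseteq> carrier ?S"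
    using S.generate_subgroup_incl[OF _ \<sigma>.subgroup_kernel] by (auto simp: kernel_def)
  moreover from this have "generate ?S ?R \<lhd> ?S"
    by (intro S.subgroup_imp_normal S.generate_is_subgroup)
  ultimately obtain \<Phi> where \<Phi>: "\<Phi> \<in> hom (?S Mod generate ?S ?R) integer_group"
    "\<And>x. x \<in> carrier ?S \<Longrightarrow> \<Phi> (generate ?S ?R #>\<^bsub>?S\<^esub> x) = \<sigma> x"
    using \<sigma>.FactGroup_universal_kernel by metis
  show ?thesis
  proof
    show "\<Phi> \<in> hom (direct_limit I G F) integer_group"
      using \<Phi>(1) by (simp add: direct_limit_def)
    show "\<Phi> (limit_class I G F i x) = \<phi> i x" if "i \<in> I" "x \<in> carrier (G i)" for i x
      using \<Phi>(2) sum_inclusion_closed[of I G i x] gr that \<sigma>_incl[OF that(1)] by (simp add: limit_class_def)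
  qed
qed

definition cech_class :: "'a topology \<Rightarrow> nat \<Rightarrow> 'a set set \<Rightarrow> 'a cochain \<Rightarrow> ('a set set \<Rightarrow> 'a cochain set) set" where
  "cech_class X n U c =
     limit_class {U. open_cover X U} (\<lambda>U. nerve_cohomology U n)
       {(U, V, refinement_map V n r) | U V r. open_cover X U \<and> open_cover X V \<and> refinement U V r}
       U (coboundaries U n #>\<^bsub>cocycle_group U n\<^esub> c)"

lemma coset_in_nerve_cohomology:
  "c \<in> carrier (cocycle_group U n) \<Longrightarrow>
    coboundaries U n #>\<^bsub>cocycle_group U n\<^esub> c \<in> carrier (nerve_cohomology U n)"
  by (auto simp: nerve_cohomology_def FactGroup_def RCOSETS_def)

lemma cech_class_closed:
  assumes "open_cover X U" "c \<in> carrier (cocycle_group U n)"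
  shows "cech_class X n U c \<in> carrier (cech_cohomology X n)"
  unfolding cech_class_def cech_cohomology_def
  by (rule limit_class_closed) (use assms in \<open>auto intro: comm_group_nerve_cohomology coset_in_nerve_cohomology\<close>)

text \<open>
  What has to be checked for an assignment of integers to cocycles in order that it descends to Cech
  cohomology.
\<close>
lemma cech_functional:
  fixes \<phi> :: "'a set set \<Rightarrow> 'a cochain \<Rightarrow> int"
  assumes add: "\<And>U c d. open_cover X U \<Longrightarrow> c \<in> carrier (cocycle_group U n) \<Longrightarrow>
      d \<in> carrier (cocycle_group U n) \<Longrightarrow> \<phi> U (\<lambda>s. c s + d s) = \<phi> U c + \<phi> U d"
    and bound: "\<And>U c. open_cover X U \<Longrightarrow> c \<in> coboundaries U n \<Longrightarrow> \<phi> U c = 0"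
    and pull: "\<And>U V r c. open_cover X U \<Longrightarrow> open_cover X V \<Longrightarrow> refinement U V r \<Longrightarrow>
      c \<in> carrier (cocycle_group U n) \<Longrightarrow> \<phi> V (cochain_pullback V n r c) = \<phi> U c"
  obtains \<Phi> where "\<Phi> \<in> hom (cech_cohomology X n) integer_group"
    and "\<And>U c. open_cover X U \<Longrightarrow> c \<in> carrier (cocycle_group U n) \<Longrightarrow> \<Phi> (cech_class X n U c) = \<phi> U c"
proof -
  have "\<exists>\<psi>. \<psi> \<in> hom (nerve_cohomology U n) integer_group \<and>
      (\<forall>c\<in>carrier (cocycle_group U n). \<psi> (coboundaries U n #>\<^bsub>cocycle_group U n\<^esub> c) = \<phi> U c)"
    if U: "open_cover X U" for U
  proof -
    interpret Z: comm_group "cocycle_group U n"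
      by (rule comm_group_cocycle_group)
    have "\<phi> U \<in> hom (cocycle_group U n) integer_group"
      by (rule homI) (use add[OF U] in \<open>simp_all add: cocycle_group_def cochain_group_def\<close>)
    then interpret \<phi>: group_hom "cocycle_group U n" integer_group "\<phi> U"
      by (simp add: group_hom_def group_hom_axioms_def Z.is_group)
    have "coboundaries U n \<subseteq> kernel (cocycle_group U n) integer_group (\<phi> U)"
      using subgroup.subset[OF subgroup_coboundaries[of U n]] bound[OF U] by (auto simp: kernel_def)
    then show ?thesis
      using \<phi>.FactGroup_universal_kernel[OF Z.subgroup_imp_normal[OF subgroup_coboundaries]]
      unfolding nerve_cohomology_def by metis
  qed
  then obtain \<psi> where \<psi>: "\<And>U. open_cover X U \<Longrightarrow> \<psi> U \<in> hom (nerve_cohomology U n) integer_group"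
    "\<And>U c. open_cover X U \<Longrightarrow> c \<in> carrier (cocycle_group U n) \<Longrightarrow>
        \<psi> U (coboundaries U n #>\<^bsub>cocycle_group U n\<^esub> c) = \<phi> U c"
    by metis
  let ?F = "{(U, V, refinement_map V n r) | U V r. open_cover X U \<and> open_cover X V \<and> refinement U V r}"
  have compatible: "\<psi> V (f h) = \<psi> U h" if f: "(U, V, f) \<in> ?F" and h: "h \<in> carrier (nerve_cohomology U n)" for U V f h
  proof -
    obtain r where r: "f = refinement_map V n r" "open_cover X U" "open_cover X V" "refinement U V r"
      using f by blast
    obtain c where c: "c \<in> carrier (cocycle_group U n)" "h = coboundaries U n #>\<^bsub>cocycle_group U n\<^esub> c"
      using h by (auto simp: nerve_cohomology_def FactGroup_def RCOSETS_def)
    show ?thesis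
      using r c \<psi>(2) pull hom_in_carrier[OF cocycle_pullback_hom[OF r(4)] c(1)]
      by (simp add: refinement_map_coset)
  qed
  obtain \<Phi> where "\<Phi> \<in> hom (direct_limit {U. open_cover X U} (\<lambda>U. nerve_cohomology U n) ?F) integer_group"
    "\<And>U h. U \<in> {U. open_cover X U} \<Longrightarrow> h \<in> carrier (nerve_cohomology U n) \<Longrightarrow>
       \<Phi> (limit_class {U. open_cover X U} (\<lambda>U. nerve_cohomology U n) ?F U h) = \<psi> U h"
    by (rule direct_limit_functional[of "{U. open_cover X U}" "\<lambda>U. nerve_cohomology U n" ?F \<psi>])
      (use \<psi>(1) compatible in \<open>auto intro: comm_group_nerve_cohomology refinement_map_hom\<close>)
  then show ?thesis
    using \<psi>(2) by (intro that) (auto simp: cech_cohomology_def cech_class_def coset_in_nerve_cohomology)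
qed

section \<open>The holonomy of a cocycle along a pair of asymptotic paths\<close>

text \<open>
  A primitive of the 1-cocycle \<open>c\<close> pulled back along the path \<open>\<gamma>\<close>: on the preimage in \<open>I\<close> of each
  cover element \<open>u\<close> it is a locally constant function \<open>\<lambda>t. g t u\<close>, and two such functions differ by
  \<open>c\<close> on overlaps. So it exhibits the pullback of \<open>c\<close> as a coboundary with locally constant
  coefficients. Continuity of the path only matters through the cover, and is expressed in
  \<open>covers_path\<close> below.
\<close>
definition primitive ::
    "'a set set \<Rightarrow> 'a cochain \<Rightarrow> (real \<Rightarrow> 'a) \<Rightarrow> real set \<Rightarrow> (real \<Rightarrow> 'a set \<Rightarrow> int) \<Rightarrow> bool" where
  "primitive U c \<gamma> I g \<longleftrightarrow>
     (\<forall>t\<in>I. \<forall>u\<in>U. \<gamma> t \<in> u \<longrightarrow>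
        (\<forall>v\<in>U. \<gamma> t \<in> v \<longrightarrow> g t v - g t u = c [u, v]) \<and>
        (\<forall>\<^sub>F s in at t within I. g s u = g t u))"

definition covers_path :: "'a set set \<Rightarrow> (real \<Rightarrow> 'a) \<Rightarrow> bool" where
  "covers_path U \<gamma> \<longleftrightarrow> (\<forall>u\<in>U. open {t. \<gamma> t \<in> u}) \<and> (\<forall>t. \<exists>u\<in>U. \<gamma> t \<in> u)"

lemma covers_path_eventually:
  "covers_path U \<gamma> \<Longrightarrow> u \<in> U \<Longrightarrow> \<gamma> t \<in> u \<Longrightarrow> \<forall>\<^sub>F s in at t within I. \<gamma> s \<in> u"
  unfolding covers_path_def eventually_at_topological
  by (intro exI[of _ "{s. \<gamma> s \<in> u}"]) auto

lemma primitive_subset: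
  assumes g: "primitive U c \<gamma> I g" and "J \<subseteq> I"
  shows "primitive U c \<gamma> J g"
  unfolding primitive_def
proof (intro ballI impI conjI)
  fix t u assume t: "t \<in> J" "u \<in> U" "\<gamma> t \<in> u"
  with \<open>J \<subseteq> I\<close> have "t \<in> I" by blast
  with g t show "g t v - g t u = c [u, v]" if "v \<in> U" "\<gamma> t \<in> v" for v
    using that by (simp add: primitive_def)
  have "\<forall>\<^sub>F s in at t within I. g s u = g t u"
    using g t \<open>t \<in> I\<close> by (simp add: primitive_def)
  then show "\<forall>\<^sub>F s in at t within J. g s u = g t u"
    by (rule filter_leD[OF at_le[OF \<open>J \<subseteq> I\<close>]])
qed

text \<open>
  The difference of two primitives of the same cocycle does not depend on the cover element in which it
  is taken, and it is locally constant in \<open>t\<close>. With \<open>\<gamma>' = \<gamma>\<close> this is the uniqueness of primitives up to a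
  constant; with two different paths it says that the difference of the primitives can change only
  where the paths do not share a cover element.
\<close>
lemma primitive_difference_const:
  assumes U: "covers_path U \<gamma>" "covers_path U \<gamma>'"
    and g: "primitive U c \<gamma> I g" "primitive U c \<gamma>' I g'"
    and I: "connected I"
    and common: "\<And>t. t \<in> I \<Longrightarrow> \<exists>u\<in>U. \<gamma> t \<in> u \<and> \<gamma>' t \<in> u"
  shows "\<exists>k. \<forall>t\<in>I. \<forall>u\<in>U. \<gamma> t \<in> u \<and> \<gamma>' t \<in> u \<longrightarrow> g t u = g' t u + k"
proof -
  obtain \<sigma> where \<sigma>: "\<And>t. t \<in> I \<Longrightarrow> \<sigma> t \<in> U \<and> \<gamma> t \<in> \<sigma> t \<and> \<gamma>' t \<in> \<sigma> t"
    using common by metis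
  define d where "d t = g t (\<sigma> t) - g' t (\<sigma> t)" for t
  have d: "d t = g t u - g' t u" if "t \<in> I" "u \<in> U" "\<gamma> t \<in> u" "\<gamma>' t \<in> u" for t u
  proof -
    have "g t u - g t (\<sigma> t) = c [\<sigma> t, u]" "g' t u - g' t (\<sigma> t) = c [\<sigma> t, u]"
      using g \<sigma>[of t] that by (auto simp: primitive_def)
    then show ?thesis by (simp add: d_def)
  qed
  have "\<forall>\<^sub>F s in at t within I. d t = d s" if "t \<in> I" for t
  proof -
    note s = \<sigma>[OF that]
    have "\<forall>\<^sub>F s in at t within I. g s (\<sigma> t) = g t (\<sigma> t)"
      "\<forall>\<^sub>F s in at t within I. g' s (\<sigma> t) = g' t (\<sigma> t)"
      using g s that by (auto simp: primitive_def)
    moreover have "\<forall>\<^sub>F s in at t within I. \<gamma> s \<in> \<sigma> t" "\<forall>\<^sub>F s in at t within I. \<gamma>' s \<in> \<sigma> t"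
      using U s by (auto intro: covers_path_eventually)
    moreover have "\<forall>\<^sub>F s in at t within I. s \<in> I"
      by (simp add: eventually_at_filter)
    ultimately show ?thesis
    proof eventually_elim
      case (elim s)
      then show ?case
        using s that d[of s "\<sigma> t"] by (simp add: d_def)
    qed
  qed
  then have "d t = d s" if "t \<in> I" "s \<in> I" for s t
    using connected_local_const[OF I that] by blast
  then show ?thesis
    using d by (metis add.commute diff_add_cancel)
qed

text \<open>
  Shift the second primitive by a constant so that it agrees with the first one at \<open>b\<close> in one
  cover element; the cocycle then makes them agree at \<open>b\<close> in all of them.
\<close>
lemma primitive_glue:
  assumes U: "covers_path U \<gamma>" and ab: "a \<le> b" "b \<le> c'"
    and g: "primitive U c \<gamma> {a..b} g1" "primitive U c \<gamma> {b..c'} g2"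
  shows "\<exists>g. primitive U c \<gamma> {a..c'} g"
proof -
  obtain w where w: "w \<in> U" "\<gamma> b \<in> w"
    using U by (auto simp: covers_path_def)
  define h where "h t u = g2 t u + (g1 b w - g2 b w)" for t u
  define g where "g t = (if t \<le> b then g1 t else h t)" for t
  have h: "primitive U c \<gamma> {b..c'} h"
    using g(2) by (simp add: primitive_def h_def)
  have agree: "g1 b u = h b u" if "u \<in> U" "\<gamma> b \<in> u" for u
  proof -
    have "g1 b u - g1 b w = c [w, u]" "g2 b u - g2 b w = c [w, u]"
      using g w that ab by (auto simp: primitive_def)
    then show ?thesis by (simp add: h_def)
  qed
  have split: "at t within {a..c'} = sup (at t within {a..b}) (at t within {b..c'})" for t
    using ab by (simp add: at_within_union[symmetric] ivl_disj_un_two_touch)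
  have "\<forall>\<^sub>F s in at t within {a..c'}. g s u = g t u"
    if t: "t \<in> {a..c'}" and u: "u \<in> U" "\<gamma> t \<in> u" for t u
  proof -
    have "\<forall>\<^sub>F s in at t within {a..b}. g s u = g t u"
    proof (cases "t \<le> b")
      case True
      then have "\<forall>\<^sub>F s in at t within {a..b}. g1 s u = g1 t u"
        using g(1) t u by (auto simp: primitive_def)
      moreover have "\<forall>\<^sub>F s in at t within {a..b}. s \<in> {a..b}"
        by (simp add: eventually_at_filter)
      ultimately show ?thesis
        by eventually_elim (use True in \<open>simp add: g_def\<close>)
    next
      case False
      have "open {b<..}" "t \<in> {b<..}" using False by auto
      then have "\<forall>\<^sub>F s in at t within {a..b}. s \<in> {b<..}"
        unfolding eventually_at_topological by blast
      moreover have "\<forall>\<^sub>F s in at t within {a..b}. s \<in> {a..b}"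
        by (simp add: eventually_at_filter)
      ultimately show ?thesis
        by eventually_elim auto
    qed
    moreover have "\<forall>\<^sub>F s in at t within {b..c'}. g s u = g t u"
    proof (cases "b \<le> t")
      case True
      have gt: "g t u = h t u"
        using True agree u by (cases "t = b") (auto simp: g_def)
      have "\<forall>\<^sub>F s in at t within {b..c'}. h s u = h t u"
        using h t u True by (auto simp: primitive_def)
      moreover have "\<forall>\<^sub>F s in at t within {b..c'}. s \<in> {b..c'}"
        by (simp add: eventually_at_filter)
      moreover have "\<forall>\<^sub>F s in at t within {b..c'}. \<gamma> s \<in> u"
        using U u by (auto intro: covers_path_eventually)
      ultimately show ?thesis
      proof eventually_elim
        case (elim s)
        then show ?case
          using agree u gt by (cases "s = b") (auto simp: g_def)
      qed
    next
      case False
      have "open {..<b}" "t \<in> {..<b}" using False by auto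
      then have "\<forall>\<^sub>F s in at t within {b..c'}. s \<in> {..<b}"
        unfolding eventually_at_topological by blast
      moreover have "\<forall>\<^sub>F s in at t within {b..c'}. s \<in> {b..c'}"
        by (simp add: eventually_at_filter)
      ultimately show ?thesis
        by eventually_elim auto
    qed
    ultimately show ?thesis
      by (simp add: split eventually_sup)
  qed
  moreover have "g t v - g t u = c [u, v]"
    if "t \<in> {a..c'}" "u \<in> U" "\<gamma> t \<in> u" "v \<in> U" "\<gamma> t \<in> v" for t u v
    using that g(1) h by (cases "t \<le> b") (auto simp: primitive_def g_def)
  ultimately have "primitive U c \<gamma> {a..c'} g"
    by (simp add: primitive_def)
  then show ?thesis by blast
qed

lemma cocycle_add:
  assumes c: "c \<in> carrier (cocycle_group U 1)"
    and "u \<in> U" "v \<in> U" "w \<in> U" "x \<in> u" "x \<in> v" "x \<in> w"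
  shows "c [u, w] = c [u, v] + c [v, w]"
proof -
  have "[u, v, w] \<in> nerve U (Suc 1)"
    using assms by (auto simp: nerve_def)
  then have "coboundary U 1 c [u, v, w] = c [v, w] - c [u, w] + c [u, v]"
    by (simp add: coboundary_def face_def numeral_2_eq_2)
  moreover have "coboundary U 1 c = (\<lambda>_. 0)"
    using c by (simp add: cocycle_group_def)
  ultimately show ?thesis by simp
qed

text \<open>
  Near a point, where the path stays in a single cover element \<open>u\<close>, the cocycle condition says that
  \<open>c [u, v]\<close> is a primitive; a subdivision of the interval and gluing do the rest.
\<close>
lemma primitive_exists_on_interval:
  assumes U: "covers_path U \<gamma>" and c: "c \<in> carrier (cocycle_group U 1)" and "a \<le> b"
  shows "\<exists>g. primitive U c \<gamma> {a..b} g"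
  using \<open>a \<le> b\<close>
proof (induction rule: Bolzano)
  case (trans a b c')
  then show ?case
    using primitive_glue[OF U] by metis
next
  case (local x)
  obtain u where u: "u \<in> U" "\<gamma> x \<in> u"
    using U by (auto simp: covers_path_def)
  then have "open {t. \<gamma> t \<in> u}" "x \<in> {t. \<gamma> t \<in> u}"
    using U by (auto simp: covers_path_def)
  then obtain d where d: "d > 0" "ball x d \<subseteq> {t. \<gamma> t \<in> u}"
    unfolding open_contains_ball by blast
  have "primitive U c \<gamma> {a..b} (\<lambda>_ v. c [u, v])" if "a \<le> x" "x \<le> b" "b - a < d" for a b
  proof -
    have "\<gamma> t \<in> u" if "t \<in> {a..b}" for t
    proof -
      have "t \<in> ball x d"
        using that \<open>a \<le> x\<close> \<open>x \<le> b\<close> \<open>b - a < d\<close> by (auto simp: dist_real_def)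
      with d show ?thesis by blast
    qed
    then have "c [u, w] - c [u, v] = c [v, w]"
      if "t \<in> {a..b}" "v \<in> U" "\<gamma> t \<in> v" "w \<in> U" "\<gamma> t \<in> w" for t v w
      using cocycle_add[OF c u(1) that(2,4) _ that(3,5)] that(1) by simp
    then show ?thesis
      by (simp add: primitive_def)
  qed
  with d(1) show ?case by blast
qed

text \<open>
  Primitives on the intervals \<open>[-n, n]\<close>, normalised to vanish at time \<open>0\<close> in a fixed cover element,
  extend each other.
\<close>
lemma primitive_exists:
  assumes U: "covers_path U \<gamma>" and c: "c \<in> carrier (cocycle_group U 1)"
  obtains g where "primitive U c \<gamma> UNIV g"
proof -
  obtain w where w: "w \<in> U" "\<gamma> 0 \<in> w"
    using U by (auto simp: covers_path_def)
  have "\<exists>g. primitive U c \<gamma> {- real n..real n} g \<and> g 0 w = 0" for n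
  proof -
    obtain g where g: "primitive U c \<gamma> {- real n..real n} g"
      using primitive_exists_on_interval[OF U c, of "- real n" "real n"] by auto
    then have "primitive U c \<gamma> {- real n..real n} (\<lambda>t u. g t u - g 0 w)"
      by (simp add: primitive_def)
    then show ?thesis by (intro exI[of _ "\<lambda>t u. g t u - g 0 w"]) simp
  qed
  then obtain G where G: "\<And>n. primitive U c \<gamma> {- real n..real n} (G n)" "\<And>n. G n 0 w = 0"
    by metis
  have G_eq: "G m t u = G n t u" if "n \<le> m" "\<bar>t\<bar> \<le> real n" "u \<in> U" "\<gamma> t \<in> u" for m n t u
  proof -
    have "primitive U c \<gamma> {- real n..real n} (G m)"
      using G(1)[of m] by (rule primitive_subset) (use that in auto)
    then obtain k where k: "\<forall>t\<in>{- real n..real n}. \<forall>u\<in>U. \<gamma> t \<in> u \<and> \<gamma> t \<in> u \<longrightarrow> G m t u = G n t u + k"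
      using primitive_difference_const[OF U U _ G(1)] U by (metis connected_Icc covers_path_def)
    then have "k = 0"
      using G(2) w by force
    moreover have "t \<in> {- real n..real n}"
      using that(2) by (simp add: abs_le_iff)
    ultimately show ?thesis
      using k that(3,4) by simp
  qed
  define g where "g t = G (nat \<lceil>\<bar>t\<bar>\<rceil> + 1) t" for t
  \<comment> \<open>the slack of 2 lets one and the same \<open>n\<close> serve for all times near \<open>t\<close>\<close>
  have g_eq: "g t u = G n t u" if "\<bar>t\<bar> + 2 \<le> real n" "u \<in> U" "\<gamma> t \<in> u" for t u n
  proof -
    have "nat \<lceil>\<bar>t\<bar>\<rceil> + 1 \<le> n" "\<bar>t\<bar> \<le> real (nat \<lceil>\<bar>t\<bar>\<rceil> + 1)"
      using that by linarith+
    then show ?thesis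
      using G_eq that by (simp add: g_def)
  qed
  have "primitive U c \<gamma> UNIV g"
    unfolding primitive_def
  proof (intro ballI impI conjI)
    fix t u assume u: "u \<in> U" "\<gamma> t \<in> u"
    obtain n where n: "\<bar>t\<bar> + 3 \<le> real n"
      using real_arch_simple by blast
    have prim: "primitive U c \<gamma> {- real n..real n} (G n)" by (rule G)
    have t: "t \<in> {- real n..real n}" "t \<in> interior {- real n..real n}"
      using n by (auto simp: interior_atLeastAtMost_real)
    show "g t v - g t u = c [u, v]" if "v \<in> U" "\<gamma> t \<in> v" for v
      using prim u that t n by (simp add: primitive_def g_eq[of t n])
    have "\<forall>\<^sub>F s in at t. G n s u = G n t u"
      using prim u t unfolding primitive_def by (metis at_within_interior)
    moreover have "\<forall>\<^sub>F s in at t. \<gamma> s \<in> u"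
      using U u by (auto intro: covers_path_eventually)
    moreover have "\<forall>\<^sub>F s in at t. \<bar>s\<bar> + 2 \<le> real n"
    proof -
      have "\<forall>\<^sub>F s in at t. dist s t < 1"
        by (simp add: eventually_at) (auto intro: exI[of _ 1])
      then show ?thesis
        by eventually_elim (use n in \<open>auto simp: dist_real_def\<close>)
    qed
    ultimately show "\<forall>\<^sub>F s in at t. g s u = g t u"
      by eventually_elim (use n u in \<open>simp add: g_eq[of _ n]\<close>)
  qed
  then show ?thesis by (rule that)
qed

definition asymptotic_in :: "'a set set \<Rightarrow> (real \<Rightarrow> 'a) \<Rightarrow> (real \<Rightarrow> 'a) \<Rightarrow> bool" where
  "asymptotic_in U \<gamma> \<gamma>' \<longleftrightarrow> (\<exists>M. \<forall>t. M \<le> \<bar>t\<bar> \<longrightarrow> (\<exists>u\<in>U. \<gamma> t \<in> u \<and> \<gamma>' t \<in> u))"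

text \<open>
  The difference of \<open>g\<close> and \<open>g'\<close> is \<open>0\<close> before time \<open>-M\<close> and \<open>z\<close> after time \<open>M\<close>, wherever the two
  paths share a cover element.
\<close>
definition drift ::
    "'a set set \<Rightarrow> (real \<Rightarrow> 'a) \<Rightarrow> (real \<Rightarrow> 'a) \<Rightarrow> (real \<Rightarrow> 'a set \<Rightarrow> int) \<Rightarrow> (real \<Rightarrow> 'a set \<Rightarrow> int) \<Rightarrow>
      real \<Rightarrow> int \<Rightarrow> bool" where
  "drift U \<gamma> \<gamma>' g g' M z \<longleftrightarrow>
     (\<forall>t. \<forall>u\<in>U. \<gamma> t \<in> u \<longrightarrow> \<gamma>' t \<in> u \<longrightarrow>
        (t \<le> - M \<longrightarrow> g t u = g' t u) \<and> (M \<le> t \<longrightarrow> g t u = g' t u + z))"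

text \<open>
  A relation rather than a function, so that linearity and compatibility with refinement can be read
  off from primitives; that it defines a function is the content of \<open>holonomy_exists\<close> and
  \<open>holonomy_unique\<close>.
\<close>
definition holonomy ::
    "'a set set \<Rightarrow> (real \<Rightarrow> 'a) \<Rightarrow> (real \<Rightarrow> 'a) \<Rightarrow> 'a cochain \<Rightarrow> int \<Rightarrow> bool" where
  "holonomy U \<gamma> \<gamma>' c z \<longleftrightarrow>
     (\<exists>g g' M. primitive U c \<gamma> UNIV g \<and> primitive U c \<gamma>' UNIV g' \<and> drift U \<gamma> \<gamma>' g g' M z)"

text \<open>
  Near each end the two paths share cover elements, so the difference of the primitives is constant
  there; subtracting a constant makes it vanish at the left end.
\<close>
lemma holonomy_exists:
  assumes U: "covers_path U \<gamma>" "covers_path U \<gamma>'" "asymptotic_in U \<gamma> \<gamma>'"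
    and c: "c \<in> carrier (cocycle_group U 1)"
  shows "\<exists>z. holonomy U \<gamma> \<gamma>' c z"
proof -
  obtain g0 where g0: "primitive U c \<gamma> UNIV g0"
    using U(1) c by (rule primitive_exists)
  obtain g' where g': "primitive U c \<gamma>' UNIV g'"
    using U(2) c by (rule primitive_exists)
  obtain M where M: "\<And>t. M \<le> \<bar>t\<bar> \<Longrightarrow> \<exists>u\<in>U. \<gamma> t \<in> u \<and> \<gamma>' t \<in> u"
    using U(3) by (auto simp: asymptotic_in_def)
  have "\<exists>k. \<forall>t\<in>J. \<forall>u\<in>U. \<gamma> t \<in> u \<and> \<gamma>' t \<in> u \<longrightarrow> g0 t u = g' t u + k"
    if "connected J" "\<And>t. t \<in> J \<Longrightarrow> M \<le> \<bar>t\<bar>" for J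
    using U(1,2) primitive_subset[OF g0] primitive_subset[OF g'] that(1) M[OF that(2)]
    by (intro primitive_difference_const) auto
  from this[of "{..- M}"] this[of "{M..}"] obtain k l where
    k: "\<forall>t\<in>{..- M}. \<forall>u\<in>U. \<gamma> t \<in> u \<and> \<gamma>' t \<in> u \<longrightarrow> g0 t u = g' t u + k" and
    l: "\<forall>t\<in>{M..}. \<forall>u\<in>U. \<gamma> t \<in> u \<and> \<gamma>' t \<in> u \<longrightarrow> g0 t u = g' t u + l"
    by (force simp: connected_Iic connected_Ici)
  have "primitive U c \<gamma> UNIV (\<lambda>t u. g0 t u - k)"
    using g0 by (simp add: primitive_def)
  moreover have "drift U \<gamma> \<gamma>' (\<lambda>t u. g0 t u - k) g' M (l - k)"
    using k l by (simp add: drift_def)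
  ultimately have "holonomy U \<gamma> \<gamma>' c (l - k)"
    using g' by (auto simp: holonomy_def)
  then show ?thesis by blast
qed

lemma holonomy_unique:
  assumes U: "covers_path U \<gamma>" "covers_path U \<gamma>'" "asymptotic_in U \<gamma> \<gamma>'"
    and "holonomy U \<gamma> \<gamma>' c y" "holonomy U \<gamma> \<gamma>' c z"
  shows "y = z"
proof -
  obtain g g' M where g: "primitive U c \<gamma> UNIV g" "primitive U c \<gamma>' UNIV g'"
    "drift U \<gamma> \<gamma>' g g' M y"
    using assms(4) by (auto simp: holonomy_def)
  obtain h h' N where h: "primitive U c \<gamma> UNIV h" "primitive U c \<gamma>' UNIV h'"
    "drift U \<gamma> \<gamma>' h h' N z"
    using assms(5) by (auto simp: holonomy_def)
  obtain K where K: "\<And>t. K \<le> \<bar>t\<bar> \<Longrightarrow> \<exists>u\<in>U. \<gamma> t \<in> u \<and> \<gamma>' t \<in> u"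
    using U(3) by (auto simp: asymptotic_in_def)
  have "\<exists>k. \<forall>t\<in>UNIV. \<forall>u\<in>U. \<gamma> t \<in> u \<and> \<gamma> t \<in> u \<longrightarrow> g t u = h t u + k"
    "\<exists>k. \<forall>t\<in>UNIV. \<forall>u\<in>U. \<gamma>' t \<in> u \<and> \<gamma>' t \<in> u \<longrightarrow> g' t u = h' t u + k"
    using primitive_difference_const[OF U(1,1) g(1) h(1)] primitive_difference_const[OF U(2,2) g(2) h(2)] U
    by (simp_all add: covers_path_def)
  then obtain k l where k: "\<And>t u. u \<in> U \<Longrightarrow> \<gamma> t \<in> u \<Longrightarrow> g t u = h t u + k"
    and l: "\<And>t u. u \<in> U \<Longrightarrow> \<gamma>' t \<in> u \<Longrightarrow> g' t u = h' t u + l"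
    by auto
  define T where "T = Max {\<bar>K\<bar>, \<bar>M\<bar>, \<bar>N\<bar>}"
  have T: "K \<le> T" "M \<le> T" "N \<le> T" "0 \<le> T"
    by (auto simp: T_def)
  obtain u where u: "u \<in> U" "\<gamma> (- T) \<in> u" "\<gamma>' (- T) \<in> u"
    using K[of "- T"] T by auto
  have "k = l"
    using g(3) h(3) k[OF u(1,2)] l[OF u(1,3)] T u by (simp add: drift_def)
  obtain v where v: "v \<in> U" "\<gamma> T \<in> v" "\<gamma>' T \<in> v"
    using K[of T] T by auto
  show ?thesis
    using g(3) h(3) k[OF v(1,2)] l[OF v(1,3)] T v \<open>k = l\<close> by (simp add: drift_def)
qed

lemma holonomy_add:
  assumes "holonomy U \<gamma> \<gamma>' c y" "holonomy U \<gamma> \<gamma>' d z"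
  shows "holonomy U \<gamma> \<gamma>' (\<lambda>s. c s + d s) (y + z)"
proof -
  have add: "primitive U (\<lambda>s. c s + d s) \<beta> UNIV (\<lambda>t u. g t u + h t u)"
    if "primitive U c \<beta> UNIV g" "primitive U d \<beta> UNIV h" for \<beta> g h
    unfolding primitive_def
  proof (intro ballI impI conjI)
    fix t u assume u: "u \<in> U" "\<beta> t \<in> u"
    show "g t v + h t v - (g t u + h t u) = c [u, v] + d [u, v]" if "v \<in> U" "\<beta> t \<in> v" for v
    proof -
      have "g t v - g t u = c [u, v]" "h t v - h t u = d [u, v]"
        using \<open>primitive U c \<beta> UNIV g\<close> \<open>primitive U d \<beta> UNIV h\<close> u that by (auto simp: primitive_def)
      then show ?thesis by simp
    qed
    have "\<forall>\<^sub>F s in at t. g s u = g t u" "\<forall>\<^sub>F s in at t. h s u = h t u"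
      using that u by (auto simp: primitive_def)
    then show "\<forall>\<^sub>F s in at t. g s u + h s u = g t u + h t u"
      by eventually_elim simp
  qed
  obtain g g' M where g: "primitive U c \<gamma> UNIV g" "primitive U c \<gamma>' UNIV g'"
    "drift U \<gamma> \<gamma>' g g' M y"
    using assms(1) by (auto simp: holonomy_def)
  obtain h h' N where h: "primitive U d \<gamma> UNIV h" "primitive U d \<gamma>' UNIV h'"
    "drift U \<gamma> \<gamma>' h h' N z"
    using assms(2) by (auto simp: holonomy_def)
  show ?thesis
    unfolding holonomy_def
    by (intro exI[of _ "\<lambda>t u. g t u + h t u"] exI[of _ "\<lambda>t u. g' t u + h' t u"] exI[of _ "max M N"] conjI)
      (use g h in \<open>auto intro: add simp: drift_def\<close>)
qed

text \<open>
  A coboundary of \<open>b\<close> has the primitive \<open>b [u]\<close> along every path, and so no drift arises.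
\<close>
lemma holonomy_coboundary:
  assumes "c \<in> coboundaries U 1"
  shows "holonomy U \<gamma> \<gamma>' c 0"
proof -
  obtain b where b: "c = coboundary U 0 b"
    using assms by (auto simp: coboundaries_def)
  have "c [u, v] = b [v] - b [u]" if "u \<in> U" "v \<in> U" "x \<in> u" "x \<in> v" for u v x
  proof -
    have "[u, v] \<in> nerve U (Suc 0)"
      using that by (auto simp: nerve_def)
    then show ?thesis
      by (simp add: b coboundary_def face_def)
  qed
  then have "primitive U c \<beta> UNIV (\<lambda>t u. b [u])" for \<beta>
    by (fastforce simp: primitive_def)
  moreover have "drift U \<gamma> \<gamma>' (\<lambda>t u. b [u]) (\<lambda>t u. b [u]) 0 0"
    by (simp add: drift_def)
  ultimately show ?thesis
    unfolding holonomy_def by blast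
qed

lemma holonomy_pullback:
  assumes r: "refinement U V r" and "holonomy U \<gamma> \<gamma>' c z"
  shows "holonomy V \<gamma> \<gamma>' (cochain_pullback V 1 r c) z"
proof -
  have r': "r v \<in> U" "x \<in> v \<Longrightarrow> x \<in> r v" if "v \<in> V" for v x
    using r that by (auto simp: refinement_def)
  have pull: "primitive V (cochain_pullback V 1 r c) \<beta> UNIV (\<lambda>t v. g t (r v))"
    if g: "primitive U c \<beta> UNIV g" for \<beta> g
    unfolding primitive_def
  proof (intro ballI impI conjI)
    fix t u assume u: "u \<in> V" "\<beta> t \<in> u"
    show "g t (r v) - g t (r u) = cochain_pullback V 1 r c [u, v]" if "v \<in> V" "\<beta> t \<in> v" for v
    proof -
      have "[u, v] \<in> nerve V 1"
        using that u by (auto simp: nerve_def)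
      then show ?thesis
        using g u that r' by (simp add: cochain_pullback_def primitive_def)
    qed
    show "\<forall>\<^sub>F s in at t. g s (r u) = g t (r u)"
      using g u r' by (simp add: primitive_def)
  qed
  obtain g g' M where g: "primitive U c \<gamma> UNIV g" "primitive U c \<gamma>' UNIV g'"
    "drift U \<gamma> \<gamma>' g g' M z"
    using assms(2) by (auto simp: holonomy_def)
  show ?thesis
    unfolding holonomy_def
    by (intro exI[of _ "\<lambda>t v. g t (r v)"] exI[of _ "\<lambda>t v. g' t (r v)"] exI[of _ M] conjI)
      (use g r' in \<open>auto intro: pull simp: drift_def simp del: One_nat_def\<close>)
qed

section \<open>Suspensions of subshifts\<close>

definition translate :: "int \<Rightarrow> (int \<Rightarrow> letter) \<Rightarrow> int \<Rightarrow> letter" where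
  "translate n x = (\<lambda>i. x (i + n))"

lemma translate_0 [simp]: "translate 0 x = x"
  by (simp add: translate_def)

lemma translate_translate [simp]: "translate m (translate n x) = translate (m + n) x"
  by (simp add: translate_def algebra_simps)

lemma shift_eq_translate: "shift x = translate 1 x"
  by (simp add: translate_def shift_def)

definition agree_on_window :: "int \<Rightarrow> (int \<Rightarrow> letter) \<Rightarrow> (int \<Rightarrow> letter) \<Rightarrow> bool" where
  "agree_on_window N x y \<longleftrightarrow> (\<forall>i. \<bar>i\<bar> \<le> N \<longrightarrow> x i = y i)"

abbreviation full_shift :: "(int \<Rightarrow> letter) topology" where
  "full_shift \<equiv> product_topology (\<lambda>_. discrete_topology UNIV) UNIV"

lemma openin_window: "openin full_shift {y. agree_on_window N x y}"
proof -
  let ?A = "\<lambda>i. if \<bar>i\<bar> \<le> N then {x i} else UNIV"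
  have "{i. ?A i \<noteq> topspace (discrete_topology UNIV)} \<subseteq> {- N..N}"
    by (auto split: if_splits)
  then have "finite {i. ?A i \<noteq> topspace (discrete_topology UNIV)}"
    by (rule finite_subset) simp
  then have "openin full_shift (\<Pi>\<^sub>E i\<in>UNIV. ?A i)"
    by (intro product_topology_basis) auto
  moreover have "(\<Pi>\<^sub>E i\<in>UNIV. ?A i) = {y. agree_on_window N x y}"
    by (auto simp: agree_on_window_def PiE_iff split: if_splits)
  ultimately show ?thesis by simp
qed

lemma window_neighbourhood:
  assumes "openin full_shift A" "x \<in> A"
  obtains N where "{y. agree_on_window N x y} \<subseteq> A"
proof -
  obtain V where V: "finite {i. V i \<noteq> UNIV}" "x \<in> Pi\<^sub>E UNIV V" "Pi\<^sub>E UNIV V \<subseteq> A"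
    using assms by (auto simp: openin_product_topology_alt)
  define N where "N = Max (insert 0 (abs ` {i. V i \<noteq> UNIV}))"
  have N: "\<bar>i\<bar> \<le> N" if "V i \<noteq> UNIV" for i
    unfolding N_def using V(1) that by (intro Max_ge) auto
  have "y \<in> Pi\<^sub>E UNIV V" if "agree_on_window N x y" for y
  proof -
    have "x i \<in> V i" for i
      using V(2) by (simp add: PiE_iff)
    then have "y i \<in> V i" for i
      using N[of i] that by (cases "V i = UNIV") (simp_all add: agree_on_window_def, metis)
    then show ?thesis by (simp add: PiE_iff)
  qed
  with V(3) show ?thesis
    by (intro that[of N]) auto
qed

text \<open>
  Closedness is stated through windows: a word is a limit of points of \<open>S\<close> if each of its
  windows agrees with the window of some point of \<open>S\<close>.
\<close>
locale subshift =
  fixes S :: "(int \<Rightarrow> letter) set"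
  assumes translate_closed: "x \<in> S \<Longrightarrow> translate n x \<in> S"
    and limit_closed: "(\<And>N. \<exists>y\<in>S. agree_on_window N x y) \<Longrightarrow> x \<in> S"
begin

definition X where "X = subtopology full_shift S"

definition \<Omega> where "\<Omega> = suspension X shift"

definition flow :: "(int \<Rightarrow> letter) \<Rightarrow> real \<Rightarrow> ((int \<Rightarrow> letter) \<times> real) set" where
  "flow x t = suspension_rel S shift `` {(x, t)}"

lemma topspace_X [simp]: "topspace X = S"
  by (simp add: X_def)

lemma closedin_full_shift: "closedin full_shift S"
proof -
  have "\<exists>N. {y. agree_on_window N x y} \<subseteq> - S" if "x \<notin> S" for x
    using limit_closed[of x] that by blast
  then obtain N where N: "\<And>x. x \<notin> S \<Longrightarrow> {y. agree_on_window (N x) x y} \<subseteq> - S"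
    by metis
  have "x \<in> {y. agree_on_window (N x) x y}" for x
    by (simp add: agree_on_window_def)
  then have "(\<Union>x\<in>- S. {y. agree_on_window (N x) x y}) = - S"
    using N by blast
  moreover have "openin full_shift (\<Union>x\<in>- S. {y. agree_on_window (N x) x y})"
    by (intro openin_Union) (auto intro: openin_window)
  ultimately show ?thesis
    by (simp add: closedin_def Compl_eq_Diff_UNIV)
qed

lemma finite_letters: "finite (UNIV :: letter set)"
proof -
  have "x = La \<or> x = Lb" for x
    by (cases x) auto
  then have "UNIV = {La, Lb}"
    by blast
  then show ?thesis
    by (metis finite.intros)
qed

lemma compact_space_X: "compact_space X"
proof -
  have "compact_space full_shift"
    by (simp add: compact_space_product_topology compact_space_discrete_topology finite_letters)
  then show ?thesis
    unfolding X_def using closedin_full_shift closedin_compact_space compact_space_subtopology by blast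
qed

lemma openin_X_window: "openin X {y \<in> S. agree_on_window N x y}"
proof -
  have "{y \<in> S. agree_on_window N x y} = {y. agree_on_window N x y} \<inter> S"
    by auto
  then show ?thesis
    unfolding X_def by (simp only: openin_subtopology_Int openin_window)
qed

lemma openin_X_if_window_determined:
  assumes "D \<subseteq> S" and "\<And>x y. x \<in> D \<Longrightarrow> y \<in> S \<Longrightarrow> agree_on_window N x y \<Longrightarrow> y \<in> D"
  shows "openin X D"
proof -
  have "agree_on_window N x x" for x
    by (simp add: agree_on_window_def)
  then have "D = (\<Union>x\<in>D. {y \<in> S. agree_on_window N x y})"
    using assms by blast
  moreover have "openin X (\<Union>x\<in>D. {y \<in> S. agree_on_window N x y})"
    by (intro openin_Union) (auto intro: openin_X_window)
  ultimately show ?thesis by simp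
qed

lemma continuous_map_translate: "continuous_map X X (translate n)"
proof -
  have "continuous_map full_shift full_shift (translate n)"
    unfolding continuous_map_componentwise_UNIV translate_def
    by (auto intro: continuous_map_product_projection)
  then show ?thesis
    unfolding X_def
    by (intro continuous_map_into_subtopology continuous_map_from_subtopology) (auto intro: translate_closed)
qed

text \<open>
  Zigzags of steps \<open>(x, t) \<rightarrow> (S x, t - 1)\<close> and their inverses compose to a single translation by an
  integer, since the shift is invertible on \<open>S\<close>.
\<close>
lemma suspension_rel_iff:
  "((x, t), (y, s)) \<in> suspension_rel S shift \<longleftrightarrow>
     x \<in> S \<and> (\<exists>n. y = translate n x \<and> s = t - of_int n)"
proof -
  define r where "r = {((x, t), (shift x, t - 1 :: real)) | x t. x \<in> S}"
  have rel: "suspension_rel S shift = Restr ((r \<union> r\<inverse>)\<^sup>*) (S \<times> UNIV)"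
    by (simp only: suspension_rel_def Let_def r_def)
  have "\<exists>n. fst b = translate n (fst a) \<and> snd b = snd a - of_int n" if "(a, b) \<in> (r \<union> r\<inverse>)\<^sup>*" for a b
    using that
  proof (induction rule: rtrancl_induct)
    case base
    show ?case by (intro exI[of _ 0]) simp
  next
    case (step b d)
    then obtain n where n: "fst b = translate n (fst a)" "snd b = snd a - of_int n"
      by blast
    from step.hyps(2) consider "fst d = shift (fst b)" "snd d = snd b - 1"
      | "fst b = shift (fst d)" "snd b = snd d - 1"
      by (auto simp: r_def)
    then show ?case
    proof cases
      case 1
      with n show ?thesis
        by (intro exI[of _ "n + 1"]) (simp add: shift_eq_translate add.commute)
    next
      case 2
      then have "fst d = translate (- 1) (fst b)"
        by (simp add: shift_eq_translate)
      then have "fst d = translate (n - 1) (fst a)"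
        using n by simp
      with 2 n show ?thesis
        by (intro exI[of _ "n - 1"]) simp
    qed
  qed
  moreover have forward: "((x, t), (translate (int n) x, t - real n)) \<in> r\<^sup>*" if "x \<in> S" for x t n
  proof (induction n)
    case (Suc n)
    have "((translate (int n) x, t - real n), (translate (int (Suc n)) x, t - real (Suc n))) \<in> r"
      using translate_closed[OF that, of "int n"] by (auto simp: r_def shift_eq_translate)
    with Suc show ?case by (rule rtrancl_into_rtrancl)
  qed simp
  moreover have "((x, t), (translate n x, t - of_int n)) \<in> (r \<union> r\<inverse>)\<^sup>*" if "x \<in> S" for x t n
  proof (cases "0 \<le> n")
    case True
    then have "((x, t), (translate n x, t - of_int n)) \<in> r\<^sup>*"
      using forward[OF that, of t "nat n"] by simp
    then show ?thesis
      by (meson in_rtrancl_UnI)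
  next
    case False
    then have "((translate n x, t - of_int n), (x, t)) \<in> r\<^sup>*"
      using forward[OF translate_closed[OF that], of n "t - of_int n" "nat (- n)"] by simp
    then have "((x, t), (translate n x, t - of_int n)) \<in> (r\<inverse>)\<^sup>*"
      by (simp add: rtrancl_converse)
    then show ?thesis
      by (meson in_rtrancl_UnI)
  qed
  ultimately show ?thesis
    unfolding rel using translate_closed by fastforce
qed

lemma flow_eq_iff:
  assumes "x \<in> S" "y \<in> S"
  shows "flow x t = flow y s \<longleftrightarrow> (\<exists>n. y = translate n x \<and> s = t - of_int n)"
  unfolding flow_def
  using eq_equiv_class_iff[OF equiv_suspension_rel, of "(x, t)" S "(y, s)" shift] assms
  by (auto simp: suspension_rel_iff)

lemma flow_translate: "x \<in> S \<Longrightarrow> flow (translate n x) (t - of_int n) = flow x t"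
  using flow_eq_iff[OF _ translate_closed] by metis

lemma topspace_\<Omega>: "topspace \<Omega> = {flow x t | x t. x \<in> S}"
  by (auto simp: \<Omega>_def suspension_def flow_def)

lemma openin_\<Omega>:
  "openin \<Omega> V \<longleftrightarrow> V \<subseteq> {flow x t | x t. x \<in> S} \<and>
     openin (prod_topology X euclideanreal) {(x, t). x \<in> S \<and> flow x t \<in> V}"
proof -
  have "{p \<in> topspace (prod_topology X euclideanreal). suspension_rel (topspace X) shift `` {p} \<in> V} =
      {(x, t). x \<in> S \<and> flow x t \<in> V}"
    by (auto simp: flow_def)
  moreover have "(\<lambda>p. suspension_rel (topspace X) shift `` {p}) ` topspace (prod_topology X euclideanreal) =
      {flow x t | x t. x \<in> S}"
    by (auto simp: flow_def)
  ultimately show ?thesis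
    unfolding \<Omega>_def suspension_def openin_quotient_topology by simp
qed

lemma covers_path_flow:
  assumes U: "open_cover \<Omega> U" and x: "x \<in> S"
  shows "covers_path U (flow x)"
proof -
  have "open {t. flow x t \<in> u}" if "u \<in> U" for u
  proof -
    have "openin (prod_topology X euclideanreal) {(x, t). x \<in> S \<and> flow x t \<in> u}"
      using U that by (simp add: open_cover_def openin_\<Omega>)
    moreover have "continuous_map euclideanreal (prod_topology X euclideanreal) (\<lambda>t. (x, t))"
      using x by (simp add: continuous_map_pairedI)
    ultimately have "openin euclideanreal {t \<in> topspace euclideanreal. (x, t) \<in> {(x, t). x \<in> S \<and> flow x t \<in> u}}"
      by (rule openin_continuous_map_preimage[rotated])
    with x show ?thesis by simp
  qed
  moreover have "\<exists>u\<in>U. flow x t \<in> u" for t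
  proof -
    have "\<Union>U = topspace \<Omega>" "flow x t \<in> topspace \<Omega>"
      using U x by (auto simp only: open_cover_def topspace_\<Omega>)
    then show ?thesis by blast
  qed
  ultimately show ?thesis
    by (simp add: covers_path_def)
qed

text \<open>
  A Lebesgue number for the cover: by compactness of \<open>S \<times> [0, 1]\<close> there is one window size for which
  agreement on the window forces two points to share a cover element throughout a unit of time.
\<close>
lemma uniform_window:
  assumes U: "open_cover \<Omega> U"
  obtains N where "\<And>x y t. x \<in> S \<Longrightarrow> y \<in> S \<Longrightarrow> agree_on_window N x y \<Longrightarrow> t \<in> {0..1} \<Longrightarrow>
    \<exists>u\<in>U. flow x t \<in> u \<and> flow y t \<in> u"
proof -
  let ?Y = "prod_topology X euclideanreal"
  define good where "good N x t \<longleftrightarrow> (\<exists>u\<in>U. \<forall>y\<in>S. agree_on_window N x y \<longrightarrow> flow y t \<in> u)" for N x t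
  \<comment> \<open>the sets \<open>G N\<close> form an open cover of \<open>S \<times> [0, 1]\<close>; the largest \<open>N\<close> of a finite subcover works\<close>
  define G where "G N = \<Union>{W. openin ?Y W \<and> (\<forall>(x, t)\<in>W. good N x t)}" for N :: int
  have "compactin ?Y (S \<times> {0..1})"
    using compact_space_X by (auto simp: compactin_Times compact_space_def)
  moreover have "openin ?Y (G N)" for N
    unfolding G_def by (rule openin_Union) blast
  moreover have "S \<times> {0..1} \<subseteq> \<Union>(range G)"
  proof clarify
    fix x t assume x: "x \<in> S"
    obtain u where u: "u \<in> U" "flow x t \<in> u"
      using covers_path_flow[OF U x] by (auto simp: covers_path_def)
    then have "openin ?Y {(x, t). x \<in> S \<and> flow x t \<in> u}"
      using U by (simp add: open_cover_def openin_\<Omega>)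
    moreover have "(x, t) \<in> {(x, t). x \<in> S \<and> flow x t \<in> u}"
      using x u by simp
    ultimately have "\<exists>A V. openin X A \<and> openin euclideanreal V \<and> x \<in> A \<and> t \<in> V \<and>
        A \<times> V \<subseteq> {(x, t). x \<in> S \<and> flow x t \<in> u}"
      by (simp only: openin_prod_topology_alt)
    then obtain A V where AV: "openin X A" "open V" "x \<in> A" "t \<in> V" "A \<times> V \<subseteq> {(x, t). x \<in> S \<and> flow x t \<in> u}"
      by (simp only: open_openin) blast
    then obtain B where B: "openin full_shift B" "A = B \<inter> S"
      by (auto simp: X_def openin_subtopology)
    then obtain N where N: "{y. agree_on_window N x y} \<subseteq> B"
      using window_neighbourhood AV(3) by blast
    let ?W = "{y \<in> S. agree_on_window N x y} \<times> V"
    have "good N y s" if "(y, s) \<in> ?W" for y s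
    proof -
      have "flow z s \<in> u" if "z \<in> S" "agree_on_window N y z" for z
      proof -
        have "agree_on_window N x z"
          using that \<open>(y, s) \<in> ?W\<close> by (auto simp: agree_on_window_def)
        with that N B(2) have "(z, s) \<in> A \<times> V"
          using \<open>(y, s) \<in> ?W\<close> by blast
        with AV(5) show ?thesis by blast
      qed
      with u(1) show ?thesis by (auto simp: good_def)
    qed
    moreover have "openin ?Y ?W"
      using AV(2) by (simp add: openin_prod_Times_iff openin_X_window)
    moreover have "(x, t) \<in> ?W"
      using x AV(4) by (simp add: agree_on_window_def)
    ultimately show "(x, t) \<in> \<Union>(range G)"
      unfolding G_def by blast
  qed
  ultimately obtain \<F> where \<F>: "finite \<F>" "\<F> \<subseteq> range G" "S \<times> {0..1} \<subseteq> \<Union>\<F>"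
    unfolding compactin_def by (metis (mono_tags, lifting) imageE)
  then obtain I where I: "finite I" "\<F> = G ` I"
    by (meson finite_subset_image)
  define N where "N = Max (insert 0 I)"
  have N: "M \<le> N" if "M \<in> I" for M
    unfolding N_def using I(1) that by (intro Max_ge) auto
  show ?thesis
  proof (rule that)
    fix x y and t :: real
    assume x: "x \<in> S" and y: "y \<in> S" "agree_on_window N x y" and t: "t \<in> {0..1}"
    have "(x, t) \<in> \<Union>\<F>"
      using \<F>(3) x t by blast
    then obtain M where M: "M \<in> I" "good M x t"
      using I(2) by (auto simp: G_def)
    then obtain u where u: "u \<in> U" "\<And>z. z \<in> S \<Longrightarrow> agree_on_window M x z \<Longrightarrow> flow z t \<in> u"
      by (auto simp: good_def)
    have "agree_on_window M x y"
      using y(2) N[OF M(1)] by (auto simp: agree_on_window_def)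
    moreover have "agree_on_window M x x"
      by (simp add: agree_on_window_def)
    ultimately show "\<exists>u\<in>U. flow x t \<in> u \<and> flow y t \<in> u"
      using u x y(1) by blast
  qed
qed

text \<open>
  At time \<open>t\<close> only the letters near position \<open>t\<close> matter, and for large \<open>\<bar>t\<bar>\<close> these are the same in
  both words.
\<close>
lemma asymptotic_in_flow:
  assumes U: "open_cover \<Omega> U" and x: "x \<in> S" and y: "y \<in> S"
    and homoclinic: "\<And>i. D \<le> \<bar>i\<bar> \<Longrightarrow> x i = y i"
  shows "asymptotic_in U (flow x) (flow y)"
proof -
  obtain N where N: "\<And>x y t. x \<in> S \<Longrightarrow> y \<in> S \<Longrightarrow> agree_on_window N x y \<Longrightarrow> t \<in> {0..1} \<Longrightarrow>
    \<exists>u\<in>U. flow x t \<in> u \<and> flow y t \<in> u"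
    using uniform_window[OF U] by metis
  have "\<exists>u\<in>U. flow x t \<in> u \<and> flow y t \<in> u" if t: "of_int (D + N + 1) \<le> \<bar>t\<bar>" for t
  proof -
    let ?n = "\<lfloor>t\<rfloor>"
    have "D + N \<le> \<bar>?n\<bar>"
      using t by linarith
    then have "agree_on_window N (translate ?n x) (translate ?n y)"
      using homoclinic by (auto simp: agree_on_window_def translate_def)
    moreover have "t - of_int ?n \<in> {0..1}"
      by (simp add: floor_le_iff) linarith
    ultimately show ?thesis
      using N[of "translate ?n x" "translate ?n y" "t - of_int ?n"] x y
      by (simp add: translate_closed flow_translate)
  qed
  then show ?thesis
    unfolding asymptotic_in_def by blast
qed

end

section \<open>The class of a clopen section\<close>

context subshift
begin

definition flow_box :: "(int \<Rightarrow> letter) set \<Rightarrow> real \<Rightarrow> real \<Rightarrow> ((int \<Rightarrow> letter) \<times> real) set set" where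
  "flow_box D a b = {flow x t | x t. x \<in> D \<and> a < t \<and> t < b}"

lemma flow_in_box_iff:
  assumes "D \<subseteq> S" "y \<in> S"
  shows "flow y s \<in> flow_box D a b \<longleftrightarrow> (\<exists>n. translate n y \<in> D \<and> a < s - of_int n \<and> s - of_int n < b)"
proof
  assume "flow y s \<in> flow_box D a b"
  then obtain x t where x: "flow y s = flow x t" "x \<in> D" "a < t" "t < b"
    by (auto simp: flow_box_def)
  then obtain n where "x = translate n y" "t = s - of_int n"
    using flow_eq_iff[of y x s t] assms by auto
  with x show "\<exists>n. translate n y \<in> D \<and> a < s - of_int n \<and> s - of_int n < b"
    by auto
next
  assume "\<exists>n. translate n y \<in> D \<and> a < s - of_int n \<and> s - of_int n < b"
  then show "flow y s \<in> flow_box D a b"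
    unfolding flow_box_def mem_Collect_eq using flow_translate[OF assms(2)] by metis
qed

lemma openin_box:
  assumes "openin X D"
  shows "openin \<Omega> (flow_box D a b)"
proof -
  have D: "D \<subseteq> S"
    using openin_subset[OF assms] by simp
  let ?Y = "prod_topology X euclideanreal"
  let ?W = "\<lambda>n::int. {y \<in> S. translate n y \<in> D} \<times> {a + of_int n<..<b + of_int n}"
  have "openin X {y \<in> S. translate n y \<in> D}" for n
    using openin_continuous_map_preimage[OF continuous_map_translate assms] by simp
  then have "openin ?Y (\<Union>n. ?W n)"
    by (intro openin_Union) (auto simp: openin_prod_Times_iff)
  moreover have "{(y, s). y \<in> S \<and> flow y s \<in> flow_box D a b} = (\<Union>n. ?W n)"
    using D by (auto simp: flow_in_box_iff algebra_simps)
  moreover have "flow_box D a b \<subseteq> {flow x t | x t. x \<in> S}"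
    using D by (auto simp: flow_box_def)
  ultimately show ?thesis
    by (simp add: openin_\<Omega>)
qed

lemma flow_in_unit_box_iff:
  assumes "D \<subseteq> S" "y \<in> S" "0 \<le> a" "b \<le> 1"
  shows "flow y s \<in> flow_box D a b \<longleftrightarrow> translate \<lfloor>s\<rfloor> y \<in> D \<and> a < frac s \<and> frac s < b"
proof -
  have "n = \<lfloor>s\<rfloor>" if "a < s - of_int n" "s - of_int n < b" for n
    using that assms(3,4) by linarith
  then show ?thesis
    unfolding flow_in_box_iff[OF assms(1,2)] frac_def by auto
qed

lemma flow_in_seam_box_iff:
  assumes "y \<in> S"
  shows "flow y s \<in> flow_box S (- (1 / 4)) (1 / 4) \<longleftrightarrow> frac s < 1 / 4 \<or> 3 / 4 < frac s"
proof
  assume "flow y s \<in> flow_box S (- (1 / 4)) (1 / 4)"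
  then obtain n :: int where n: "- (1 / 4) < s - of_int n" "s - of_int n < 1 / 4"
    using assms by (auto simp: flow_in_box_iff)
  then have "n = \<lfloor>s\<rfloor> \<or> n = \<lfloor>s\<rfloor> + 1"
    by linarith
  with n show "frac s < 1 / 4 \<or> 3 / 4 < frac s"
    by (auto simp: frac_def)
next
  assume s: "frac s < 1 / 4 \<or> 3 / 4 < frac s"
  show "flow y s \<in> flow_box S (- (1 / 4)) (1 / 4)"
  proof (cases "frac s < 1 / 4")
    case True
    then have "- (1 / 4) < s - of_int \<lfloor>s\<rfloor>" "s - of_int \<lfloor>s\<rfloor> < 1 / 4"
      unfolding frac_def by linarith+
    then show ?thesis
      unfolding flow_in_box_iff[OF order.refl assms] using translate_closed[OF assms] by blast
  next
    case False
    with s have "- (1 / 4) < s - of_int (\<lfloor>s\<rfloor> + 1)" "s - of_int (\<lfloor>s\<rfloor> + 1) < 1 / 4"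
      unfolding frac_def of_int_add of_int_1 by linarith+
    then show ?thesis
      unfolding flow_in_box_iff[OF order.refl assms] using translate_closed[OF assms] by blast
  qed
qed

text \<open>
  A clopen set \<open>C\<close> gives a map from the suspension to the circle: a flow line winds once around
  whenever it runs through \<open>C \<times> (0, 1)\<close>, and stays at the base point otherwise. The three sets below are
  preimages of three arcs that cover the circle, the outer set being the preimage of an arc around the
  base point. The cocycle is the pullback of a generator of the cohomology of the circle; the jump is
  placed on the overlap of the upper and the outer set.
\<close>
definition outer_set where "outer_set C = flow_box S (- (1 / 4)) (1 / 4) \<union> flow_box (S - C) 0 1"
definition lower_set where "lower_set C = flow_box C 0 (2 / 3)"
definition upper_set where "upper_set C = flow_box C (1 / 3) 1"

definition crossing_cover where "crossing_cover C = {outer_set C, lower_set C, upper_set C}"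

definition crossing_cocycle :: "(int \<Rightarrow> letter) set \<Rightarrow> ((int \<Rightarrow> letter) \<times> real) set cochain" where
  "crossing_cocycle C s =
     (if s = [upper_set C, outer_set C] then 1 else if s = [outer_set C, upper_set C] then - 1 else 0)"

context
  fixes C assumes clopen: "openin X C" "openin X (S - C)" and nonempty: "C \<noteq> {}"
begin

lemma section_subset: "C \<subseteq> S"
  using openin_subset[OF clopen(1)] by simp

lemma flow_in_outer_iff:
  "y \<in> S \<Longrightarrow> flow y s \<in> outer_set C \<longleftrightarrow>
    frac s < 1 / 4 \<or> 3 / 4 < frac s \<or> (translate \<lfloor>s\<rfloor> y \<notin> C \<and> 0 < frac s)"
  by (auto simp: outer_set_def flow_in_seam_box_iff flow_in_unit_box_iff translate_closed frac_lt_1)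

lemma flow_in_lower_iff:
  "y \<in> S \<Longrightarrow> flow y s \<in> lower_set C \<longleftrightarrow> translate \<lfloor>s\<rfloor> y \<in> C \<and> 0 < frac s \<and> frac s < 2 / 3"
  using section_subset by (simp add: lower_set_def flow_in_unit_box_iff)

lemma flow_in_upper_iff:
  "y \<in> S \<Longrightarrow> flow y s \<in> upper_set C \<longleftrightarrow> translate \<lfloor>s\<rfloor> y \<in> C \<and> 1 / 3 < frac s"
  using section_subset by (simp add: upper_set_def flow_in_unit_box_iff frac_lt_1)

lemmas flow_in_iffs = flow_in_outer_iff flow_in_lower_iff flow_in_upper_iff

lemma open_cover_crossing: "open_cover \<Omega> (crossing_cover C)"
  unfolding open_cover_def
proof (intro conjI ballI)
  have "openin X S"
    using openin_topspace[of X] by simp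
  then show o: "openin \<Omega> u" if "u \<in> crossing_cover C" for u
    using that clopen
    by (auto simp: crossing_cover_def outer_set_def lower_set_def upper_set_def openin_box)
  show "\<Union>(crossing_cover C) = topspace \<Omega>"
  proof
    show "\<Union>(crossing_cover C) \<subseteq> topspace \<Omega>"
      using o openin_subset by blast
    have "flow x t \<in> \<Union>(crossing_cover C)" if "x \<in> S" for x t
    proof -
      have "0 \<le> frac t" by simp
      then show ?thesis
        using that by (auto simp: crossing_cover_def flow_in_iffs simp del: frac_gt_0_iff)
    qed
    then show "topspace \<Omega> \<subseteq> \<Union>(crossing_cover C)"
      by (auto simp: topspace_\<Omega>)
  qed
qed

lemma triple_intersection_empty: "outer_set C \<inter> lower_set C \<inter> upper_set C = {}"
proof (rule equals0I)
  fix z assume z: "z \<in> outer_set C \<inter> lower_set C \<inter> upper_set C"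
  then obtain x t where x: "z = flow x t" "x \<in> S"
    using section_subset by (auto simp: lower_set_def flow_box_def)
  with z have "flow x t \<in> outer_set C" "flow x t \<in> lower_set C" "flow x t \<in> upper_set C"
    by auto
  then show False
    using x(2) by (auto simp: flow_in_iffs)
qed

lemma cover_sets_distinct:
  "outer_set C \<noteq> lower_set C" "outer_set C \<noteq> upper_set C" "lower_set C \<noteq> upper_set C"
proof -
  obtain x where x: "x \<in> C" "x \<in> S"
    using nonempty section_subset by blast
  have frac: "frac (1 / 2) = (1 / 2 :: real)" "frac (1 / 6) = (1 / 6 :: real)"
    "\<lfloor>1 / 2 :: real\<rfloor> = 0" "\<lfloor>1 / 6 :: real\<rfloor> = 0"
    by (simp_all add: frac_eq floor_eq_iff)
  have "flow x (1 / 2) \<notin> outer_set C" "flow x (1 / 2) \<in> lower_set C" "flow x (1 / 2) \<in> upper_set C"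
    using x by (simp_all add: flow_in_iffs frac)
  moreover have "flow x (1 / 6) \<in> lower_set C" "flow x (1 / 6) \<notin> upper_set C"
    using x by (simp_all add: flow_in_iffs frac)
  ultimately show "outer_set C \<noteq> lower_set C" "outer_set C \<noteq> upper_set C" "lower_set C \<noteq> upper_set C"
    by auto
qed

lemma crossing_cocycle_closed: "crossing_cocycle C \<in> carrier (cocycle_group (crossing_cover C) 1)"
proof -
  let ?U = "crossing_cover C" and ?c = "crossing_cocycle C"
  obtain x where x: "x \<in> C" "x \<in> S"
    using nonempty section_subset by blast
  have "frac (7 / 8) = (7 / 8 :: real)" "\<lfloor>7 / 8 :: real\<rfloor> = 0"
    by (simp_all add: frac_eq floor_eq_iff)
  then have "flow x (7 / 8) \<in> upper_set C \<inter> outer_set C"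
    using x by (simp add: flow_in_iffs)
  then have "[upper_set C, outer_set C] \<in> nerve ?U 1" "[outer_set C, upper_set C] \<in> nerve ?U 1"
    by (auto simp: nerve_def crossing_cover_def)
  then have "?c \<in> carrier (cochain_group ?U 1)"
    by (auto simp: cochain_group_def crossing_cocycle_def)
  moreover have "coboundary ?U 1 ?c s = 0" for s
  proof (cases "s \<in> nerve ?U (Suc 1)")
    case True
    then obtain u v w where s: "s = [u, v, w]"
      by (auto simp: nerve_def length_Suc_conv)
    have uvw: "u \<in> ?U" "v \<in> ?U" "w \<in> ?U" "u \<inter> v \<inter> w \<noteq> {}"
      using True by (auto simp: nerve_def s)
    have "u = v \<or> v = w \<or> u = w"
    proof (rule ccontr)
      assume "\<not> (u = v \<or> v = w \<or> u = w)"
      with uvw(1-3) have "u \<inter> v \<inter> w = outer_set C \<inter> lower_set C \<inter> upper_set C"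
        unfolding crossing_cover_def by (elim insertE emptyE) (simp_all add: Int_ac)
      with uvw(4) triple_intersection_empty show False by simp
    qed
    moreover have zero: "?c [v, v] = 0" and anti: "?c [v, u] + ?c [u, v] = 0" for u v
      using cover_sets_distinct(2) by (auto simp: crossing_cocycle_def)
    ultimately have "?c [v, w] - ?c [u, w] + ?c [u, v] = 0"
    proof (elim disjE)
      assume "u = w"
      then show ?thesis using zero anti[of v u] by simp
    qed (simp_all add: zero)
    with True show ?thesis
      by (simp add: coboundary_def face_def numeral_2_eq_2 s)
  qed (simp add: coboundary_def)
  ultimately show ?thesis
    by (auto simp: cocycle_group_def)
qed

text \<open>
  Along a flow line that runs through \<open>C\<close> at most once, the lower and the upper set are met only
  between the times \<open>0\<close> and \<open>1\<close>. The only change is thus that, in the outer set, the primitive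
  is \<open>0\<close> before the crossing and \<open>1\<close> after it. The time \<open>1/2\<close> at which the value jumps lies outside the
  outer set.
\<close>
lemma primitive_crossing_cocycle:
  assumes x: "x \<in> S" and once: "\<And>n. translate n x \<in> C \<Longrightarrow> n = 0"
  shows "primitive (crossing_cover C) (crossing_cocycle C) (flow x) UNIV
    (\<lambda>t u. if u = outer_set C \<and> x \<in> C \<and> 1 / 2 \<le> t then 1 else 0)"
    (is "primitive _ _ _ _ ?g")
  unfolding primitive_def
proof (intro ballI impI conjI)
  fix t u assume u: "u \<in> crossing_cover C" "flow x t \<in> u"
  have in_C: "translate \<lfloor>t\<rfloor> x \<in> C \<longleftrightarrow> x \<in> C \<and> 0 \<le> t \<and> t < 1"
  proof -
    have "\<lfloor>t\<rfloor> = 0 \<longleftrightarrow> 0 \<le> t \<and> t < 1"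
      by (simp add: floor_eq_iff)
    then show ?thesis
      using once[of "\<lfloor>t\<rfloor>"] by auto
  qed
  have frac: "frac t = t" if "0 \<le> t" "t < 1"
    using that by (simp add: frac_eq)
  note dist = cover_sets_distinct cover_sets_distinct[symmetric]
  show "?g t v - ?g t u = crossing_cocycle C [u, v]" if v: "v \<in> crossing_cover C" "flow x t \<in> v" for v
    using u v dist frac
    by (auto simp: crossing_cover_def crossing_cocycle_def flow_in_iffs[OF x] in_C)
  show "\<forall>\<^sub>F s in at t. ?g s u = ?g t u"
  proof (cases "u = outer_set C \<and> x \<in> C")
    case True
    have "t \<noteq> 1 / 2"
    proof
      assume "t = 1 / 2"
      with True u(2) in_C frac show False
        by (auto simp: flow_in_outer_iff[OF x])
    qed
    have "\<forall>\<^sub>F s in at t. if t < 1 / 2 then s < 1 / 2 else 1 / 2 < s"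
    proof (cases "t < 1 / 2")
      case True
      show ?thesis
        using order_tendstoD(2)[OF tendsto_ident_at True] True by simp
    next
      case False
      with \<open>t \<noteq> 1 / 2\<close> have "1 / 2 < t" by simp
      from order_tendstoD(1)[OF tendsto_ident_at this] False show ?thesis by simp
    qed
    then show ?thesis
      by eventually_elim (auto split: if_splits)
  qed auto
qed

lemma holonomy_crossing_cocycle:
  assumes "x \<in> S" "\<And>n. translate n x \<in> C \<Longrightarrow> n = 0"
    and "y \<in> S" "\<And>n. translate n y \<in> C \<Longrightarrow> n = 0"
  shows "holonomy (crossing_cover C) (flow x) (flow y) (crossing_cocycle C)
    ((if x \<in> C then 1 else 0) - (if y \<in> C then 1 else 0))"
proof -
  let ?g = "\<lambda>x t u. if u = outer_set C \<and> x \<in> C \<and> 1 / 2 \<le> t then 1 else 0 :: int"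
  have "u = outer_set C" if "1 \<le> t" "u \<in> crossing_cover C" "flow x t \<in> u" for t u
  proof -
    have "translate \<lfloor>t\<rfloor> x \<notin> C"
    proof
      assume "translate \<lfloor>t\<rfloor> x \<in> C"
      then have "\<lfloor>t\<rfloor> = 0" by (rule assms(2))
      with that(1) show False by linarith
    qed
    with that show ?thesis
      by (auto simp: crossing_cover_def flow_in_iffs[OF assms(1)])
  qed
  then have "drift (crossing_cover C) (flow x) (flow y) (?g x) (?g y) 1
      ((if x \<in> C then 1 else 0) - (if y \<in> C then 1 else 0))"
    unfolding drift_def by auto
  then show ?thesis
    unfolding holonomy_def using primitive_crossing_cocycle assms by blast
qed

end

end

section \<open>Points of the random Fibonacci subshift\<close>

lemma realisation_append:
  "realisation p w w' \<Longrightarrow> realisation p v v' \<Longrightarrow> realisation p (w @ v) (w' @ v')"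
  unfolding realisation_def by (metis concat_append list_all2_appendI)

text \<open>
  Letters are replaced independently of each other.
\<close>
lemma realisation_power_append:
  "(realisation p ^^ k) w w' \<Longrightarrow> (realisation p ^^ k) v v' \<Longrightarrow> (realisation p ^^ k) (w @ v) (w' @ v')"
proof (induction k arbitrary: w' v')
  case (Suc k)
  then obtain w1 v1 where "(realisation p ^^ k) w w1" "realisation p w1 w'"
    "(realisation p ^^ k) v v1" "realisation p v1 v'"
    by (elim relpowp_Suc_E)
  then show ?case
    using Suc.IH realisation_append by (intro relpowp_Suc_I[of _ _ _ "w1 @ v1"])
qed simp

lemma realisation_single:
  "realisation p [x] u \<longleftrightarrow> u \<in> set_pmf (random_fibonacci p x)"
  by (auto simp: realisation_def list_all2_Cons1)

text \<open>
  Realisations of \<open>a\<close> that begin with \<open>b\<close>, so that their limit and its mirror image meet in \<open>bb\<close>.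
\<close>
fun fib_word :: "nat \<Rightarrow> letter list" where
  "fib_word 0 = [Lb, La]"
| "fib_word (Suc 0) = [Lb, La, La]"
| "fib_word (Suc (Suc n)) = fib_word (Suc n) @ fib_word n"

text \<open>
  Exchange of a block \<open>ba\<close> at position \<open>q\<close> for \<open>ab\<close>. Positions beyond the end of the list are ignored,
  so that the definition also applies to prefixes that end before the block.
\<close>
definition swap_at :: "nat \<Rightarrow> letter list \<Rightarrow> letter list" where
  "swap_at q u = u[q := La, Suc q := Lb]"

context
  fixes p :: real
  assumes p: "0 < p" "p < 1"
begin

lemma realisation_Lb: "(realisation p ^^ k) [La] v \<Longrightarrow> (realisation p ^^ Suc k) [Lb] v"
  by (rule relpowp_Suc_I2[of _ _ "[La]"]) (auto simp: realisation_single set_random_fibonacci[OF p])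

text \<open>
  The first step sends \<open>a\<close> to \<open>ab\<close> or \<open>ba\<close>, so realisations of \<open>a\<close> and of \<open>b\<close> of the same level can be
  joined in either order.
\<close>
lemma realisation_La:
  assumes "(realisation p ^^ k) [La] v" "(realisation p ^^ k) [Lb] w"
  shows "(realisation p ^^ Suc k) [La] (v @ w)" "(realisation p ^^ Suc k) [La] (w @ v)"
proof -
  have step: "realisation p [La] [La, Lb]" "realisation p [La] [Lb, La]"
    by (auto simp: realisation_single set_random_fibonacci[OF p])
  have rest: "(realisation p ^^ k) [La, Lb] (v @ w)" "(realisation p ^^ k) [Lb, La] (w @ v)"
    using realisation_power_append[OF assms] realisation_power_append[OF assms(2,1)] by simp_all
  show "(realisation p ^^ Suc k) [La] (v @ w)"
    using step(1) rest(1) by (rule relpowp_Suc_I2)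
  show "(realisation p ^^ Suc k) [La] (w @ v)"
    using step(2) rest(2) by (rule relpowp_Suc_I2)
qed

lemma realisation_fib_word_base:
  "(realisation p ^^ 1) [La] [Lb, La]" "(realisation p ^^ 1) [La] [La, Lb]"
  by (auto simp: realisation_single set_random_fibonacci[OF p])

text \<open>
  The reversed words are realisations, too, because the set of realisations is closed under reversal.
\<close>
lemma realisation_fib_word:
  "(realisation p ^^ Suc n) [La] (fib_word n) \<and> (realisation p ^^ Suc n) [La] (rev (fib_word n))"
proof (induction n rule: fib_word.induct)
  case 1
  show ?case using realisation_fib_word_base by simp
next
  case 2
  have "(realisation p ^^ Suc 0) [Lb] [La]"
    by (rule realisation_Lb) simp
  then show ?case
    using realisation_La[of "Suc 0" "[Lb, La]" "[La]"] realisation_La[of "Suc 0" "[La, Lb]" "[La]"]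
      realisation_fib_word_base by simp
next
  case (3 n)
  then show ?case
    using realisation_La[of "Suc (Suc n)"] realisation_Lb[of "Suc n"] by (simp del: relpowp.simps)
qed

end

lemma length_fib_word: "n < length (fib_word n)"
  by (induction n rule: fib_word.induct) auto

lemma length_fib_word_less: "length (fib_word n) < length (fib_word (Suc n))"
  by (induction n rule: fib_word.induct) auto

lemma strict_mono_length_fib_word: "strict_mono (\<lambda>n. length (fib_word n))"
  by (rule strict_monoI_Suc) (rule length_fib_word_less)

lemma nth_fib_word_Suc: "i < length (fib_word n) \<Longrightarrow> fib_word (Suc n) ! i = fib_word n ! i"
proof (cases n)
  case 0
  then show "i < length (fib_word n) \<Longrightarrow> fib_word (Suc n) ! i = fib_word n ! i"
    by (auto simp: less_Suc_eq numeral_2_eq_2)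
qed (simp add: nth_append)

lemma nth_fib_word_mono:
  assumes "n \<le> m" "i < length (fib_word n)"
  shows "fib_word m ! i = fib_word n ! i"
  using assms(1)
proof (induction m rule: dec_induct)
  case (step m)
  then have "length (fib_word n) \<le> length (fib_word m)"
    using strict_mono_less_eq[OF strict_mono_length_fib_word] by blast
  with step assms(2) show ?case
    by (simp add: nth_fib_word_Suc)
qed simp

lemma fib_word_begin: "\<exists>u. fib_word (Suc n) = [Lb, La, La] @ u"
proof (induction n)
  case (Suc n)
  then obtain u where "fib_word (Suc n) = [Lb, La, La] @ u" by blast
  then show ?case by simp
qed simp

text \<open>
  Here the word \<open>f (i + 1)\<close> starts within \<open>f (i + 3) = f (i + 2) f (i + 1)\<close>. As \<open>i + 1 > 0\<close>, it starts with
  \<open>baa\<close>, and the second \<open>a\<close> prevents a new \<open>bb\<close> after the exchange of \<open>ba\<close> for \<open>ab\<close>.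
\<close>
definition swap_position :: "nat \<Rightarrow> nat" where
  "swap_position i = length (fib_word (i + 2))"

lemma realisation_swap_begin:
  assumes p: "0 < p" "p < 1"
  shows "(realisation p ^^ Suc n) [La] (swap_at 0 (fib_word n))"
proof (induction n rule: fib_word.induct)
  case 1
  show ?case using realisation_fib_word_base[OF p] by (simp add: swap_at_def)
next
  case 2
  have "(realisation p ^^ Suc 0) [Lb] [La]"
    by (rule realisation_Lb[OF p]) simp
  then show ?case
    using realisation_La[OF p, of "Suc 0" "[La, Lb]" "[La]"] realisation_fib_word_base[OF p]
    by (simp add: swap_at_def)
next
  case (3 n)
  have "swap_at 0 (fib_word (Suc (Suc n))) = swap_at 0 (fib_word (Suc n)) @ fib_word n"
    using fib_word_begin[of n] by (auto simp: swap_at_def)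
  then show ?case
    using 3 realisation_La(1)[OF p] realisation_Lb[OF p, of "Suc n"] realisation_fib_word[OF p, of n]
    by (simp del: relpowp.simps fib_word.simps)
qed

text \<open>
  Up to \<open>f (i + 2)\<close> the block is not reached; in \<open>f (i + 3)\<close> it is the beginning of the second factor;
  afterwards it lies inside the first factor.
\<close>
lemma realisation_swap:
  assumes p: "0 < p" "p < 1"
  shows "(realisation p ^^ Suc m) [La] (swap_at (swap_position i) (fib_word m))"
proof (induction m rule: less_induct)
  case (less m)
  consider "m \<le> i + 2" | "m = i + 3" | "i + 3 < m"
    by linarith
  then show ?case
  proof cases
    case 1
    then have "length (fib_word m) \<le> swap_position i"
      using strict_mono_less_eq[OF strict_mono_length_fib_word, of m "i + 2"]
      by (simp add: swap_position_def del: fib_word.simps)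
    then have "swap_at (swap_position i) (fib_word m) = fib_word m"
      by (simp add: swap_at_def list_update_beyond)
    then show ?thesis
      using realisation_fib_word[OF p, of m] by simp
  next
    case 2
    then have m: "m = Suc (Suc (i + 1))" by simp
    have "swap_at (swap_position i) (fib_word m) = fib_word (i + 2) @ swap_at 0 (fib_word (i + 1))"
      by (simp add: m swap_at_def swap_position_def list_update_append)
    moreover have "(realisation p ^^ Suc (i + 2)) [La] (fib_word (i + 2))"
      using realisation_fib_word[OF p] by blast
    moreover have "(realisation p ^^ Suc (i + 2)) [Lb] (swap_at 0 (fib_word (i + 1)))"
      using realisation_Lb[OF p realisation_swap_begin[OF p, of "i + 1"]] by simp
    ultimately show ?thesis
      using realisation_La(1)[OF p] by (simp add: m del: relpowp.simps fib_word.simps)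
  next
    case 3
    then obtain n where n: "m = Suc (Suc n)" "i + 2 \<le> n"
      using less_imp_Suc_add[OF 3] by auto
    have "length (fib_word (Suc (i + 2))) \<le> length (fib_word (Suc n))"
      using n strict_mono_less_eq[OF strict_mono_length_fib_word] by blast
    moreover have "Suc (swap_position i) < length (fib_word (Suc (i + 2)))"
      using length_fib_word[of "i + 1"] by (simp add: swap_position_def)
    ultimately have "swap_at (swap_position i) (fib_word m) =
        swap_at (swap_position i) (fib_word (Suc n)) @ fib_word n"
      by (simp add: n swap_at_def list_update_append)
    moreover have "(realisation p ^^ Suc (Suc n)) [La] (swap_at (swap_position i) (fib_word (Suc n)))"
      using less.IH[of "Suc n"] n by simp
    moreover have "(realisation p ^^ Suc (Suc n)) [Lb] (fib_word n)"
      using realisation_Lb[OF p] realisation_fib_word[OF p, of n] by blast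
    ultimately show ?thesis
      using realisation_La(1)[OF p] by (simp add: n del: relpowp.simps fib_word.simps)
  qed
qed

definition fib_letter :: "nat \<Rightarrow> letter" where
  "fib_letter n = fib_word n ! n"

lemma fib_letter_eq:
  assumes "n < length (fib_word m)"
  shows "fib_letter n = fib_word m ! n"
  using nth_fib_word_mono[of n m n] nth_fib_word_mono[of m n n] assms length_fib_word[of n]
  by (cases "n \<le> m") (auto simp: fib_letter_def)

lemma map_fib_letter: "map fib_letter [0..<length (fib_word m)] = fib_word m"
  by (rule nth_equalityI) (auto simp: fib_letter_eq)

lemma fib_letter_at_swap:
  "fib_letter (swap_position i) = Lb" "fib_letter (swap_position i + 1) = La"
  "fib_letter (swap_position i + 2) = La"
proof -
  obtain u where u: "fib_word (i + 3) = fib_word (i + 2) @ [Lb, La, La] @ u"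
    using fib_word_begin[of i] by (auto simp: eval_nat_numeral)
  have "fib_letter (swap_position i + k) = ([Lb, La, La] @ u) ! k" if "k < 3" for k
    using that fib_letter_eq[of "swap_position i + k" "i + 3"] unfolding u
    by (simp add: swap_position_def nth_append)
  from this[of 0] this[of 1] this[of 2]
  show "fib_letter (swap_position i) = Lb" "fib_letter (swap_position i + 1) = La"
    "fib_letter (swap_position i + 2) = La"
    by simp_all
qed

lemma inj_swap_position: "swap_position i = swap_position j \<longleftrightarrow> i = j"
  using strict_mono_eq[OF strict_mono_length_fib_word, of "i + 2" "j + 2"]
  by (simp add: swap_position_def del: fib_word.simps)

definition no_bb :: "letter list \<Rightarrow> bool" where
  "no_bb = successively (\<lambda>x y. x = Lb \<longrightarrow> y = La)"

lemma no_bb_fib_word: "no_bb (fib_word n) \<and> last (fib_word n) = La \<and> fib_word n \<noteq> []"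
  by (induction n rule: fib_word.induct) (auto simp: no_bb_def successively_append_iff)

lemma no_bb_fib_letter:
  assumes "fib_letter n = Lb"
  shows "fib_letter (Suc n) = La"
proof -
  have "Suc n < length (fib_word (Suc n))"
    by (rule length_fib_word)
  then show ?thesis
    using no_bb_fib_word[of "Suc n"] assms fib_letter_eq[of n "Suc n"] fib_letter_eq[of "Suc n" "Suc n"]
    by (auto simp: no_bb_def successively_conv_nth)
qed

text \<open>
  The left half is always the mirror image of the limit word; only the right half varies.
\<close>
definition two_sided :: "(nat \<Rightarrow> letter) \<Rightarrow> int \<Rightarrow> letter" where
  "two_sided r n = (if 0 \<le> n then r (nat n) else fib_letter (nat (- n - 1)))"

lemma map_two_sided:
  "map (two_sided r) [- int (length (fib_word m))..int (length (fib_word m)) - 1] =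
    rev (fib_word m) @ map r [0..<length (fib_word m)]"
proof (rule nth_equalityI)
  let ?l = "length (fib_word m)"
  fix k assume k: "k < length (map (two_sided r) [- int ?l..int ?l - 1])"
  then have "map (two_sided r) [- int ?l..int ?l - 1] ! k = two_sided r (int k - int ?l)"
    by simp
  also have "\<dots> = (rev (fib_word m) @ map r [0..<?l]) ! k"
  proof (cases "k < ?l")
    case True
    then have "nat (- (int k - int ?l) - 1) = ?l - Suc k"
      by linarith
    with True show ?thesis
      using fib_letter_eq[of "?l - Suc k" m] by (simp add: two_sided_def nth_append rev_nth)
  next
    case False
    with k show ?thesis
      by (simp add: two_sided_def nth_append nat_diff_distrib)
  qed
  finally show "map (two_sided r) [- int ?l..int ?l - 1] ! k = (rev (fib_word m) @ map r [0..<?l]) ! k" .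
qed simp

text \<open>
  Every window lies in some word \<open>rev (f m)\<close> followed by the prefix of \<open>r\<close> of the same length. Both parts
  are realisations of \<open>a\<close> of level \<open>m + 1\<close>, which cannot be joined at once. But the right part is also a
  realisation of \<open>b\<close> of the next level, and the left part is the end of a realisation \<open>q @ rev (f m)\<close>
  of \<open>a\<close> of the next level.
\<close>
lemma two_sided_in_fibonacci_words:
  assumes p: "0 < p" "p < 1"
    and r: "\<And>m. (realisation p ^^ Suc m) [La] (map r [0..<length (fib_word m)])"
  shows "two_sided r \<in> fibonacci_words p"
proof -
  have "\<exists>k v. (realisation p ^^ k) [Lb] v \<and> sublist (map (two_sided r) [i..j]) v" for i j
  proof -
    define m where "m = nat (\<bar>i\<bar> + \<bar>j\<bar> + 1)"
    let ?l = "length (fib_word m)" and ?R = "map r [0..<length (fib_word m)]"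
    have "(realisation p ^^ m) [La] (case m of 0 \<Rightarrow> [La] | Suc n \<Rightarrow> fib_word n)"
      using realisation_fib_word[OF p] by (cases m) auto
    then obtain q where q: "(realisation p ^^ Suc m) [Lb] q"
      using realisation_Lb[OF p] by blast
    have "(realisation p ^^ Suc (Suc m)) [La] (q @ rev (fib_word m))"
      using realisation_La(2)[OF p _ q] realisation_fib_word[OF p, of m] by blast
    then have "(realisation p ^^ Suc (Suc (Suc m))) [La] ((q @ rev (fib_word m)) @ ?R)"
      by (rule realisation_La(1)[OF p _ realisation_Lb[OF p r]])
    then have "(realisation p ^^ Suc (Suc (Suc (Suc m)))) [Lb] ((q @ rev (fib_word m)) @ ?R)"
      by (rule realisation_Lb[OF p])
    moreover have "sublist (map (two_sided r) [i..j]) ((q @ rev (fib_word m)) @ ?R)"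
    proof (cases "i \<le> j")
      case True
      have "m < ?l" by (rule length_fib_word)
      then have ij: "- int ?l \<le> i" "j \<le> int ?l - 1"
        by (auto simp: m_def)
      then have "[- int ?l..int ?l - 1] = [- int ?l..i - 1] @ [i..j] @ [j + 1..int ?l - 1]"
        using True upto_split1[of "- int ?l" i "int ?l - 1"] upto_split2[of i j "int ?l - 1"] by simp
      then have "rev (fib_word m) @ ?R = map (two_sided r) [- int ?l..i - 1] @
          map (two_sided r) [i..j] @ map (two_sided r) [j + 1..int ?l - 1]"
        by (simp only: map_two_sided[symmetric] map_append)
      then show ?thesis
        unfolding append_assoc by (metis append_assoc sublist_appendI)
    qed simp
    ultimately show ?thesis by blast
  qed
  then show ?thesis
    by (simp add: fibonacci_words_def)
qed

definition base_word :: "int \<Rightarrow> letter" where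
  "base_word = two_sided fib_letter"

definition swapped_word :: "nat \<Rightarrow> int \<Rightarrow> letter" where
  "swapped_word i = two_sided (fib_letter(swap_position i := La, swap_position i + 1 := Lb))"

lemma base_word_in:
  assumes "0 < p" "p < 1"
  shows "base_word \<in> fibonacci_words p"
  unfolding base_word_def
  by (rule two_sided_in_fibonacci_words[OF assms])
    (use realisation_fib_word[OF assms] in \<open>simp add: map_fib_letter del: relpowp.simps\<close>)

lemma swapped_word_in:
  assumes "0 < p" "p < 1"
  shows "swapped_word i \<in> fibonacci_words p"
  unfolding swapped_word_def
proof (rule two_sided_in_fibonacci_words[OF assms])
  fix m
  let ?q = "swap_position i"
  have "map (fib_letter(?q := La, ?q + 1 := Lb)) [0..<length (fib_word m)] = swap_at ?q (fib_word m)"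
    by (rule nth_equalityI) (auto simp: swap_at_def nth_list_update fib_letter_eq)
  then show "(realisation p ^^ Suc m) [La]
      (map (fib_letter(?q := La, ?q + 1 := Lb)) [0..<length (fib_word m)])"
    using realisation_swap[OF assms] by metis
qed

text \<open>
  A \<open>b\<close> is followed by an \<open>a\<close> when moving away from the centre on either side, so a \<open>bb\<close> has to
  straddle the centre.
\<close>
lemma bb_two_sided:
  assumes r: "\<And>n. r n = Lb \<Longrightarrow> r (Suc n) = La"
    and bb: "two_sided r (n - 1) = Lb" "two_sided r n = Lb"
  shows "n = 0"
proof (rule ccontr)
  assume "n \<noteq> 0"
  then consider "0 < n" | "n < 0" by linarith
  then show False
  proof cases
    case 1
    then have "nat n = Suc (nat (n - 1))" by linarith
    with 1 bb r[of "nat (n - 1)"] show False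
      by (simp add: two_sided_def)
  next
    case 2
    then have "nat (- (n - 1) - 1) = Suc (nat (- n - 1))" by linarith
    with 2 bb no_bb_fib_letter[of "nat (- n - 1)"] show False
      by (simp add: two_sided_def)
  qed
qed

lemma bb_base_word: "base_word (n - 1) = Lb \<Longrightarrow> base_word n = Lb \<Longrightarrow> n = 0"
  unfolding base_word_def by (rule bb_two_sided) (rule no_bb_fib_letter)

lemma bb_swapped_word: "swapped_word i (n - 1) = Lb \<Longrightarrow> swapped_word i n = Lb \<Longrightarrow> n = 0"
  unfolding swapped_word_def
proof (rule bb_two_sided)
  let ?q = "swap_position i"
  fix n assume "(fib_letter(?q := La, ?q + 1 := Lb)) n = Lb"
  then show "(fib_letter(?q := La, ?q + 1 := Lb)) (Suc n) = La"
    using no_bb_fib_letter[of n] fib_letter_at_swap[of i] by (auto split: if_splits)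
qed

lemma homoclinic_swapped_word: "int (swap_position i) + 2 \<le> \<bar>n\<bar> \<Longrightarrow> base_word n = swapped_word i n"
  by (auto simp: base_word_def swapped_word_def two_sided_def nat_eq_iff)

lemma base_word_at_swap: "base_word (int (swap_position j)) = Lb"
  by (simp add: base_word_def two_sided_def fib_letter_at_swap)

lemma swapped_word_at_swap: "swapped_word i (int (swap_position j)) = Lb \<longleftrightarrow> i \<noteq> j"
  using fib_letter_at_swap inj_swap_position by (auto simp: swapped_word_def two_sided_def)

lemma center_bb:
  "base_word (- 1) = Lb" "base_word 0 = Lb" "swapped_word i (- 1) = Lb" "swapped_word i 0 = Lb"
proof -
  have "swap_position i \<noteq> 0"
    unfolding swap_position_def using length_fib_word[of "i + 2"] by linarith
  then show "base_word (- 1) = Lb" "base_word 0 = Lb" "swapped_word i (- 1) = Lb" "swapped_word i 0 = Lb"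
    by (auto simp: base_word_def swapped_word_def two_sided_def fib_letter_def)
qed

section \<open>The cohomology of the random Fibonacci tiling space\<close>

context subshift
begin

lemma homoclinic_functional:
  assumes x: "x \<in> S" and y: "y \<in> S" and homoclinic: "\<And>i. D \<le> \<bar>i\<bar> \<Longrightarrow> x i = y i"
  shows "\<exists>\<Phi>\<in>hom (cech_cohomology \<Omega> 1) integer_group.
    \<forall>U c z. open_cover \<Omega> U \<longrightarrow> c \<in> carrier (cocycle_group U 1) \<longrightarrow>
      holonomy U (flow x) (flow y) c z \<longrightarrow> \<Phi> (cech_class \<Omega> 1 U c) = z"
proof -
  let ?hol = "\<lambda>U c. THE z. holonomy U (flow x) (flow y) c z"
  have asymp: "covers_path U (flow x)" "covers_path U (flow y)" "asymptotic_in U (flow x) (flow y)"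
    if "open_cover \<Omega> U" for U
    using covers_path_flow[OF that] asymptotic_in_flow[OF that x y homoclinic] x y by auto
  have hol_eq: "?hol U c = z" if "open_cover \<Omega> U" "holonomy U (flow x) (flow y) c z" for U c z
    using that(2) holonomy_unique[OF asymp[OF that(1)]] by (intro the_equality) auto
  have hol: "holonomy U (flow x) (flow y) c (?hol U c)"
    if "open_cover \<Omega> U" "c \<in> carrier (cocycle_group U 1)" for U c
    using holonomy_exists[OF asymp[OF that(1)] that(2)] hol_eq[OF that(1)] by metis
  obtain \<Phi> where \<Phi>: "\<Phi> \<in> hom (cech_cohomology \<Omega> 1) integer_group"
    "\<And>U c. open_cover \<Omega> U \<Longrightarrow> c \<in> carrier (cocycle_group U 1) \<Longrightarrow> \<Phi> (cech_class \<Omega> 1 U c) = ?hol U c"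
  proof (rule cech_functional[of \<Omega> 1 ?hol])
    show "?hol U (\<lambda>s. c s + d s) = ?hol U c + ?hol U d"
      if "open_cover \<Omega> U" "c \<in> carrier (cocycle_group U 1)" "d \<in> carrier (cocycle_group U 1)" for U c d
      using hol_eq[OF that(1) holonomy_add[OF hol[OF that(1,2)] hol[OF that(1,3)]]] .
    show "?hol U c = 0" if "open_cover \<Omega> U" "c \<in> coboundaries U 1" for U c
      using hol_eq[OF that(1) holonomy_coboundary[OF that(2)]] .
    show "?hol V (cochain_pullback V 1 r c) = ?hol U c"
      if "open_cover \<Omega> U" "open_cover \<Omega> V" "refinement U V r" "c \<in> carrier (cocycle_group U 1)" for U V r c
      using hol_eq[OF that(2) holonomy_pullback[OF that(3) hol[OF that(1,4)]]] .
  qed blast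
  show ?thesis
  proof (intro bexI[OF _ \<Phi>(1)] allI impI)
    fix U c z
    assume "open_cover \<Omega> U" "c \<in> carrier (cocycle_group U 1)" "holonomy U (flow x) (flow y) c z"
    then show "\<Phi> (cech_class \<Omega> 1 U c) = z"
      using \<Phi>(2) hol_eq by metis
  qed
qed

lemma cech_cohomology_not_finitely_generated:
  fixes y :: "nat \<Rightarrow> int \<Rightarrow> letter" and C :: "nat \<Rightarrow> (int \<Rightarrow> letter) set"
  assumes x: "x \<in> S" and y: "\<And>i. y i \<in> S" and homoclinic: "\<And>i. \<exists>D. \<forall>n. D \<le> \<bar>n\<bar> \<longrightarrow> x n = y i n"
    and clopen: "\<And>j. openin X (C j)" "\<And>j. openin X (S - C j)"
    and once_x: "\<And>j n. translate n x \<in> C j \<Longrightarrow> n = 0" and once_y: "\<And>i j n. translate n (y i) \<in> C j \<Longrightarrow> n = 0"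
    and x_in: "\<And>j. x \<in> C j" and y_in: "\<And>i j. y i \<in> C j \<longleftrightarrow> i \<noteq> j"
  shows "\<not> finitely_generated (cech_cohomology \<Omega> 1)"
proof -
  let ?h = "\<lambda>j. cech_class \<Omega> 1 (crossing_cover (C j)) (crossing_cocycle (C j))"
  have nonempty: "C j \<noteq> {}" for j
    using x_in by blast
  note cover = open_cover_crossing[OF clopen nonempty]
    and cocycle = crossing_cocycle_closed[OF clopen nonempty]
  have "\<exists>\<Phi>. \<Phi> \<in> hom (cech_cohomology \<Omega> 1) integer_group \<and> (\<forall>j. \<Phi> (?h j) = (if i = j then 1 else 0))" for i
  proof -
    obtain D where D: "\<And>n. D \<le> \<bar>n\<bar> \<Longrightarrow> x n = y i n"
      using homoclinic by blast
    obtain \<Phi> where \<Phi>: "\<Phi> \<in> hom (cech_cohomology \<Omega> 1) integer_group"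
      "\<And>U c z. open_cover \<Omega> U \<Longrightarrow> c \<in> carrier (cocycle_group U 1) \<Longrightarrow>
        holonomy U (flow x) (flow (y i)) c z \<Longrightarrow> \<Phi> (cech_class \<Omega> 1 U c) = z"
      using homoclinic_functional[OF x y D] by blast
    have "holonomy (crossing_cover (C j)) (flow x) (flow (y i)) (crossing_cocycle (C j))
        ((if x \<in> C j then 1 else 0) - (if y i \<in> C j then 1 else 0))" for j
      by (rule holonomy_crossing_cocycle[OF clopen nonempty x once_x y once_y])
    then have "\<Phi> (?h j) = (if x \<in> C j then 1 else 0) - (if y i \<in> C j then 1 else 0)" for j
      by (rule \<Phi>(2)[OF cover cocycle])
    then have "\<forall>j. \<Phi> (?h j) = (if i = j then 1 else 0)"
      by (simp add: x_in y_in)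
    with \<Phi>(1) show ?thesis by blast
  qed
  then have "\<exists>\<phi>. \<forall>i. \<phi> i \<in> hom (cech_cohomology \<Omega> 1) integer_group \<and>
      (\<forall>j. \<phi> i (?h j) = (if i = j then 1 else 0))"
    by (intro choice allI)
  then obtain \<phi> where \<phi>: "\<And>i. \<phi> i \<in> hom (cech_cohomology \<Omega> 1) integer_group"
    "\<And>i j. \<phi> i (?h j) = (if i = j then 1 else 0)"
    by blast
  show ?thesis
    by (rule not_finitely_generated_if_dual_family[where \<phi> = \<phi> and h = ?h])
      (rule comm_group.axioms(2)[OF comm_group_cech_cohomology] \<phi> cech_class_closed[OF cover cocycle])+
qed

end

lemma subshift_fibonacci_words: "subshift (fibonacci_words p)"
proof
  fix x n assume x: "x \<in> fibonacci_words p"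
  have "map (translate n x) [i..j] = map x [i + n..j + n]" for i j
    by (rule nth_equalityI) (auto simp: translate_def algebra_simps)
  with x show "translate n x \<in> fibonacci_words p"
    by (simp add: fibonacci_words_def)
next
  fix x :: "int \<Rightarrow> letter"
  assume x: "\<And>N. \<exists>y\<in>fibonacci_words p. agree_on_window N x y"
  have "\<exists>k v. (realisation p ^^ k) [Lb] v \<and> sublist (map x [i..j]) v" for i j
  proof -
    obtain y where y: "y \<in> fibonacci_words p" "agree_on_window (max \<bar>i\<bar> \<bar>j\<bar>) x y"
      using x by blast
    have eq: "map x [i..j] = map y [i..j]"
      using y(2) by (auto simp: agree_on_window_def)
    show ?thesis
      using y(1) unfolding fibonacci_words_def eq by blast
  qed
  then show "x \<in> fibonacci_words p"
    by (simp add: fibonacci_words_def)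
qed

theorem theorem6p1:
  fixes p :: real
  assumes "0 < p" and "p < 1"
  shows "\<not> finitely_generated (cech_cohomology (random_fibonacci_space p) 1)"
proof -
  interpret subshift "fibonacci_words p"
    by (rule subshift_fibonacci_words)
  have space: "random_fibonacci_space p = \<Omega>"
    by (simp add: random_fibonacci_space_def fibonacci_symbolic_def \<Omega>_def X_def)
  define C where "C j = {x \<in> fibonacci_words p. x (- 1) = Lb \<and> x 0 = Lb \<and> x (int (swap_position j)) = Lb}" for j
  have clopen: "openin X (C j)" "openin X (fibonacci_words p - C j)" for j
    by (rule openin_X_if_window_determined[where N = "int (swap_position j) + 1"];
        auto simp: C_def agree_on_window_def)+
  show ?thesis
    unfolding space
  proof (rule cech_cohomology_not_finitely_generated)
    show "base_word \<in> fibonacci_words p" "swapped_word i \<in> fibonacci_words p" for i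
      by (rule base_word_in[OF assms] swapped_word_in[OF assms])+
    show "\<exists>D. \<forall>n. D \<le> \<bar>n\<bar> \<longrightarrow> base_word n = swapped_word i n" for i
      using homoclinic_swapped_word by blast
    show "n = 0" if "translate n base_word \<in> C j" for n j
      using that bb_base_word[of n] by (simp add: C_def translate_def)
    show "n = 0" if "translate n (swapped_word i) \<in> C j" for n i j
      using that bb_swapped_word[of i n] by (simp add: C_def translate_def)
    show "base_word \<in> C j" "swapped_word i \<in> C j \<longleftrightarrow> i \<noteq> j" for i j
      by (simp_all add: C_def base_word_in[OF assms] swapped_word_in[OF assms] center_bb
          base_word_at_swap swapped_word_at_swap)
  qed (rule clopen)+
qed

end
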